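(* Let $D$ be a binary delta-matroid. In each of the following seven triples of properties, any two of the properties imply the third: 1. $\{D$ is even; $D^{+}$ is even; $D$ is bipartite$\}$; 2. $\{D$ is even; $D^{*+}$ is even; $D^{*}$ is bipartite$\}$; 3. $\{D$ is even; $D^{+*}$ is bipartite; $D$ is $Z_3$-bipartite$\}$; 4. $\{D^{+}$ is even; $D^{*+}$ is even; $D^{+*}$ is bipartite$\}$; 5. $\{D^{+}$ is even; $D^{*}$ is bipartite; $D$ is $Z_3$-bipartite$\}$; 6. $\{D$ is bipartite; $D^{*+}$ is even; $D$ is $Z_3$-bipartite$\}$; 7. $\{D$ is bipartite; $D^{*}$ is bipartite; $D^{+*}$ is bipartite$\}$.
   Context: All sets are finite; $\triangle$ is symmetric difference. Delta-matroids. A set system is a pair $(E,\mathcal F)$ with $\mathcal F\subseteq 2^E$ (the feasible sets). A delta-matroid is a set system $D=(E,\mathcal F)$ with $\mathcal F\ne\varnothing$ such that for all $X,Y\in\mathcal F$ and $u\in X\triangle Y$ there is $v\in X\triangle Y$ (possibly $v=u$) with $X\triangle\{u,v\}\in\mathcal F$. $D$ is even if all feasible sets have the same parity of cardinality. $D_{\min}$ is the matroid on $E$ whose bases are the feasible sets of minimum cardinality; $D$ is bipartite if every circuit of $D_{\min}$ has even cardinality. Twist: $D*X=(E,\{F\triangle X:F\in\mathcal F\})$ for $X\subseteq E$. Loop complementation at $e\in E$: $D+e=(E,\mathcal F\triangle\{F\cup\{e\}:F\in\mathcal F,\ e\notin F\})$; these commute for distinct elements, and $D+X$ denotes applying $+e$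 for all $e\in X$. Write $D^*=D*E$, $D^+=D+E$, $D^{+*}=(D+E)*E$, $D^{*+}=(D*E)+E$. For a symmetric matrix $A$ over $\mathbb F_2$ indexed by $E$, $D(A)=(E,\{X\subseteq E: A[X]\text{ nonsingular}\})$, where $A[X]$ is the principal submatrix and the empty matrix is nonsingular. $D$ is binary if some twist of $D$ is isomorphic to some such $D(A)$. Multimatroids. A carrier $(U,\Omega)$ is a set $U$ with a partition $\Omega$ into skew classes. A subtransversal (transversal) meets each skew class in at most (exactly) one element. A multimatroid $Z=(U,\Omega,\mathcal I)$ has $\mathcal I$ a family of subtransversals (independent sets) such that (1) for each transversal $T$, $\mathcal I\cap 2^T$ is the family of independent sets of a matroid on $T$; (2) for every $I\in\mathcal I$ and every two distinct elements $x,y$ of one skew class disjoint from $I$, $I\cup\{x\}\in\mathcal I$ or $I\cup\{y\}\in\mathcal I$. Bases are the maximal independent sets; circuits are the minimal subtransversals that are not independent. For $X\subseteq U$, $Z-X$ is the multimatroid on $U\setminus X$, with skew classes the nonempty sets $\omega\setminus X$, whose independent sets are those of $Z$ contained in $U\setminus X$. A $3$-matroid is a multimatroid all of whose skew classes have size $3$; it is tight if for every basis $X$ and skew class $\omega$, exactly one of the transversals $(X\setminus\omega)\cup\{u\}$, $u\in\omega$, is not a basis. The tight $3$-matroid $Z_3(D,\tau)$. For each $e\in E$ let $\omega_e=\{e_1,e_2,e_3\}$ (pairwise disjoint), $U=\bigcup_e\omega_e$, $\Omega=\{\omega_e:e\in E\}$, $T_i=\{e_i:e\in E\}$, $\tau=(T_1,T_2,T_3)$.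 For a tight $3$-matroid $Z$ on $(U,\Omega)$, $D_{Z,\tau}$ is the set system on $E$ in which $X$ is feasible iff $\{e_1:e\in E\setminus X\}\cup\{e_2:e\in X\}$ is a basis of $Z-T_3$. For a binary delta-matroid $D$ it is known that there is a unique tight $3$-matroid $Z$ on $(U,\Omega)$ with $D=D_{Z,\tau}$; it is denoted $Z_3(D,\tau)$. $D$ is $Z_3$-bipartite if every circuit of $Z_3(D,\tau)$ has even cardinality. *)

theory Defs
  imports Main "HOL-Library.Disjoint_Sets" "HOL-Library.Z2"
begin

section \<open>Matroids\<close>

definition matroid :: "'a set \<Rightarrow> 'a set set \<Rightarrow> bool" where
  "matroid E \<I> \<longleftrightarrow>
     finite E \<and> \<I> \<subseteq> Pow E \<and> {} \<in> \<I> \<and>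
     (\<forall>I\<in>\<I>. \<forall>J. J \<subseteq> I \<longrightarrow> J \<in> \<I>) \<and>
     (\<forall>I\<in>\<I>. \<forall>J\<in>\<I>. card I < card J \<longrightarrow> (\<exists>x\<in>J - I. insert x I \<in> \<I>))"

definition matroid_circuits :: "'a set \<Rightarrow> 'a set set \<Rightarrow> 'a set set" where
  "matroid_circuits E \<I> =
     {C. C \<subseteq> E \<and> C \<notin> \<I> \<and> (\<forall>C'. C' \<subset> C \<longrightarrow> C' \<in> \<I>)}"


section \<open>Set systems and delta-matroids\<close>

record 'a set_system =
  ground :: "'a set"
  feasible :: "'a set set"

definition delta_matroid :: "'a set_system \<Rightarrow> bool" where
  "delta_matroid D \<longleftrightarrow>
     finite (ground D) \<and> feasible D \<subseteq> Pow (ground D) \<and> feasible D \<noteq> {} \<and>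
     (\<forall>X\<in>feasible D. \<forall>Y\<in>feasible D. \<forall>u\<in>sym_diff X Y.
        \<exists>v\<in>sym_diff X Y. sym_diff X {u, v} \<in> feasible D)"

definition even_system :: "'a set_system \<Rightarrow> bool" where
  "even_system D \<longleftrightarrow>
     (\<forall>X\<in>feasible D. \<forall>Y\<in>feasible D. even (card X) \<longleftrightarrow> even (card Y))"

definition min_feasible :: "'a set_system \<Rightarrow> 'a set set" where
  "min_feasible D = {B \<in> feasible D. \<forall>F\<in>feasible D. card B \<le> card F}"

text \<open>The matroid \<open>D\<^sub>m\<^sub>i\<^sub>n\<close>, whose bases are the sets in \<^const>\<open>min_feasible\<close>,
  given by its independent sets.\<close>

definition Dmin_indep :: "'a set_system \<Rightarrow> 'a set set" where
  "Dmin_indep D = {I. \<exists>B\<in>min_feasible D. I \<subseteq> B}"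

definition bipartite :: "'a set_system \<Rightarrow> bool" where
  "bipartite D \<longleftrightarrow> (\<forall>C\<in>matroid_circuits (ground D) (Dmin_indep D). even (card C))"

definition twist :: "'a set_system \<Rightarrow> 'a set \<Rightarrow> 'a set_system" where
  "twist D X = \<lparr>ground = ground D, feasible = (\<lambda>F. sym_diff F X) ` feasible D\<rparr>"

definition loop_compl :: "'a \<Rightarrow> 'a set_system \<Rightarrow> 'a set_system" where
  "loop_compl e D =
     \<lparr>ground = ground D,
      feasible = sym_diff (feasible D) {F \<union> {e} | F. F \<in> feasible D \<and> e \<notin> F}\<rparr>"

lemma mem_feasible_loop_compl:
  "X \<in> feasible (loop_compl e D) \<longleftrightarrow>
     (X \<in> feasible D) \<noteq> (e \<in> X \<and> X - {e} \<in> feasible D)"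
proof -
  have "X \<in> {F \<union> {e} | F. F \<in> feasible D \<and> e \<notin> F} \<longleftrightarrow> e \<in> X \<and> X - {e} \<in> feasible D"
  proof
    assume "e \<in> X \<and> X - {e} \<in> feasible D"
    then have "X = (X - {e}) \<union> {e} \<and> X - {e} \<in> feasible D \<and> e \<notin> X - {e}" by blast
    then show "X \<in> {F \<union> {e} | F. F \<in> feasible D \<and> e \<notin> F}" by blast
  qed auto
  then show ?thesis by (auto simp: loop_compl_def)
qed

text \<open>Single loop complementations commute, so the fold defining \<open>D + X\<close> below does not
  depend on an order of the elements of the finite set \<open>X\<close>.\<close>

lemma comp_fun_commute_loop_compl: "comp_fun_commute loop_compl"
proof (rule comp_fun_commute.intro, rule ext)
  fix e f :: 'a and D :: "'a set_system"
  have "ground (loop_compl f (loop_compl e D)) = ground (loop_compl e (loop_compl f D))"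
    by (simp add: loop_compl_def)
  moreover have "feasible (loop_compl f (loop_compl e D)) = feasible (loop_compl e (loop_compl f D))"
  proof (cases "e = f")
    case False
    have "X - {e} - {f} = X - {f} - {e}" for X by blast
    then have "X \<in> feasible (loop_compl f (loop_compl e D)) \<longleftrightarrow>
        X \<in> feasible (loop_compl e (loop_compl f D))" for X
      unfolding mem_feasible_loop_compl using False by (metis Diff_iff singletonD)
    then show ?thesis by blast
  qed simp
  ultimately show "(loop_compl f \<circ> loop_compl e) D = (loop_compl e \<circ> loop_compl f) D"
    by simp
qed

definition loop_compl_set :: "'a set_system \<Rightarrow> 'a set \<Rightarrow> 'a set_system" where
  "loop_compl_set D X = Finite_Set.fold loop_compl D X"

text \<open>\<open>D\<^sup>*\<close> and \<open>D\<^sup>+\<close>; thus \<open>D\<^sup>+\<^sup>*\<close> is \<open>dual (plus_all D)\<close> and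
  \<open>D\<^sup>*\<^sup>+\<close> is \<open>plus_all (dual D)\<close>.\<close>

definition dual :: "'a set_system \<Rightarrow> 'a set_system" where
  "dual D = twist D (ground D)"

definition plus_all :: "'a set_system \<Rightarrow> 'a set_system" where
  "plus_all D = loop_compl_set D (ground D)"


section \<open>Binary delta-matroids\<close>

definition set_system_iso :: "'a set_system \<Rightarrow> 'b set_system \<Rightarrow> bool" where
  "set_system_iso D D' \<longleftrightarrow>
     (\<exists>\<phi>. bij_betw \<phi> (ground D) (ground D') \<and> feasible D' = (\<lambda>F. \<phi> ` F) ` feasible D)"

text \<open>Matrices over the two-element field with rows and columns indexed by a finite set
  are functions; entries outside the index set are irrelevant. The principal submatrix on
  \<open>X\<close> is nonsingular if it has a two-sided inverse. (For \<open>X = {}\<close> this holds.)\<close>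

definition nonsingular_on :: "('a \<Rightarrow> 'a \<Rightarrow> bit) \<Rightarrow> 'a set \<Rightarrow> bool" where
  "nonsingular_on A X \<longleftrightarrow>
     (\<exists>B :: 'a \<Rightarrow> 'a \<Rightarrow> bit. \<forall>i\<in>X. \<forall>j\<in>X.
        (\<Sum>k\<in>X. A i k * B k j) = (if i = j then 1 else 0) \<and>
        (\<Sum>k\<in>X. B i k * A k j) = (if i = j then 1 else 0))"

definition matrix_system :: "'a set \<Rightarrow> ('a \<Rightarrow> 'a \<Rightarrow> bit) \<Rightarrow> 'a set_system" where
  "matrix_system E A = \<lparr>ground = E, feasible = {X. X \<subseteq> E \<and> nonsingular_on A X}\<rparr>"

text \<open>Taking the index set \<open>E'\<close> inside the type of the elements of \<open>D\<close> is no restriction,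
  as \<open>E'\<close> is in bijection with the ground set of \<open>D\<close>.\<close>

definition binary :: "'a set_system \<Rightarrow> bool" where
  "binary D \<longleftrightarrow>
     (\<exists>X (E' :: 'a set) A.
        X \<subseteq> ground D \<and> finite E' \<and> (\<forall>i\<in>E'. \<forall>j\<in>E'. A i j = A j i) \<and>
        set_system_iso (twist D X) (matrix_system E' A))"


section \<open>Multimatroids\<close>

record 'b multi_system =
  elements :: "'b set"
  classes :: "'b set set"
  indep :: "'b set set"

definition subtransversal :: "'b set \<Rightarrow> 'b set set \<Rightarrow> 'b set \<Rightarrow> bool" where
  "subtransversal U \<Omega> S \<longleftrightarrow>
     S \<subseteq> U \<and> (\<forall>\<omega>\<in>\<Omega>. \<forall>x\<in>S \<inter> \<omega>. \<forall>y\<in>S \<inter> \<omega>. x = y)"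

definition transversal :: "'b set \<Rightarrow> 'b set set \<Rightarrow> 'b set \<Rightarrow> bool" where
  "transversal U \<Omega> T \<longleftrightarrow> T \<subseteq> U \<and> (\<forall>\<omega>\<in>\<Omega>. \<exists>!x. x \<in> T \<inter> \<omega>)"

definition multimatroid :: "'b multi_system \<Rightarrow> bool" where
  "multimatroid Z \<longleftrightarrow>
     finite (elements Z) \<and> partition_on (elements Z) (classes Z) \<and>
     (\<forall>I\<in>indep Z. subtransversal (elements Z) (classes Z) I) \<and>
     (\<forall>T. transversal (elements Z) (classes Z) T \<longrightarrow> matroid T (indep Z \<inter> Pow T)) \<and>
     (\<forall>I\<in>indep Z. \<forall>\<omega>\<in>classes Z. \<forall>x\<in>\<omega>. \<forall>y\<in>\<omega>.
        \<omega> \<inter> I = {} \<and> x \<noteq> y \<longrightarrow> I \<union> {x} \<in> indep Z \<or> I \<union> {y} \<in> indep Z)"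

definition bases :: "'b multi_system \<Rightarrow> 'b set set" where
  "bases Z = {B \<in> indep Z. \<forall>I\<in>indep Z. B \<subseteq> I \<longrightarrow> I = B}"

definition circuits :: "'b multi_system \<Rightarrow> 'b set set" where
  "circuits Z =
     {C. subtransversal (elements Z) (classes Z) C \<and> C \<notin> indep Z \<and>
         (\<forall>C'. C' \<subset> C \<and> subtransversal (elements Z) (classes Z) C' \<longrightarrow> C' \<in> indep Z)}"

definition delete :: "'b multi_system \<Rightarrow> 'b set \<Rightarrow> 'b multi_system" where
  "delete Z X =
     \<lparr>elements = elements Z - X,
      classes = {\<omega> - X | \<omega>. \<omega> \<in> classes Z \<and> \<omega> - X \<noteq> {}},
      indep = {I \<in> indep Z. I \<subseteq> elements Z - X}\<rparr>"

definition tight_3_matroid :: "'b multi_system \<Rightarrow> bool" where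
  "tight_3_matroid Z \<longleftrightarrow>
     multimatroid Z \<and> (\<forall>\<omega>\<in>classes Z. card \<omega> = 3) \<and>
     (\<forall>X\<in>bases Z. \<forall>\<omega>\<in>classes Z. \<exists>!u. u \<in> \<omega> \<and> (X - \<omega>) \<union> {u} \<notin> bases Z)"


section \<open>The tight 3-matroid of a binary delta-matroid\<close>

text \<open>The element \<open>e\<^sub>i\<close> is \<open>\<tau> i e\<close>, for \<open>i \<in> {1, 2, 3}\<close>; so \<open>T\<^sub>i\<close> is the image of
  the ground set under \<open>\<tau> i\<close>. Values of \<open>\<tau>\<close> at other indices are irrelevant.\<close>

definition labelling :: "'a set \<Rightarrow> (nat \<Rightarrow> 'a \<Rightarrow> 'b) \<Rightarrow> bool" where
  "labelling E \<tau> \<longleftrightarrow> inj_on (\<lambda>(i, e). \<tau> i e) ({1, 2, 3} \<times> E)"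

definition skew_class :: "(nat \<Rightarrow> 'a \<Rightarrow> 'b) \<Rightarrow> 'a \<Rightarrow> 'b set" where
  "skew_class \<tau> e = {\<tau> 1 e, \<tau> 2 e, \<tau> 3 e}"

definition system_of :: "'a set \<Rightarrow> (nat \<Rightarrow> 'a \<Rightarrow> 'b) \<Rightarrow> 'b multi_system \<Rightarrow> 'a set_system" where
  "system_of E \<tau> Z =
     \<lparr>ground = E,
      feasible = {X. X \<subseteq> E \<and> \<tau> 1 ` (E - X) \<union> \<tau> 2 ` X \<in> bases (delete Z (\<tau> 3 ` E))}\<rparr>"

text \<open>Such a multimatroid exists and is unique for every binary delta-matroid \<open>D\<close> and every
  \<^const>\<open>labelling\<close> of its ground set.\<close>

definition Z3 :: "'a set_system \<Rightarrow> (nat \<Rightarrow> 'a \<Rightarrow> 'b) \<Rightarrow> 'b multi_system" where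
  "Z3 D \<tau> =
     (THE Z. tight_3_matroid Z \<and>
             elements Z = (\<Union>e\<in>ground D. skew_class \<tau> e) \<and>
             classes Z = skew_class \<tau> ` ground D \<and>
             system_of (ground D) \<tau> Z = D)"

definition Z3_bipartite :: "'a set_system \<Rightarrow> (nat \<Rightarrow> 'a \<Rightarrow> 'b) \<Rightarrow> bool" where
  "Z3_bipartite D \<tau> \<longleftrightarrow> (\<forall>C\<in>circuits (Z3 D \<tau>). even (card C))"


definition any_two_imply_third :: "bool \<Rightarrow> bool \<Rightarrow> bool \<Rightarrow> bool" where
  "any_two_imply_third P Q R \<longleftrightarrow>
     (P \<and> Q \<longrightarrow> R) \<and> (P \<and> R \<longrightarrow> Q) \<and> (Q \<and> R \<longrightarrow> P)"

end

theory Submission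
  imports Defs "HOL-Library.Product_Plus" "HOL-Library.FuncSet"
begin

text \<open>A binary delta-matroid is a Lagrangian subspace in disguise, and each of the seven properties
  says that one particular linear functional vanishes on that subspace.

  Let \<open>K\<close> be the Klein four-group with nonzero elements \<open>1, 2, 3\<close> (as pairs of bits
  \<open>(1, 0), (0, 1), (1, 1)\<close>), where \<open>1 + 2 = 3\<close>. Reading the value \<open>i\<close> at \<open>e\<close> as the element
  \<open>e\<^sub>i\<close> of a skew class, a function \<open>E \<rightarrow> K\<close> is the same as a subtransversal, and a function with
  no zero value is a transversal. A symmetric matrix over the two-element field, together with a
  twist, gives a subspace \<open>L\<close> of these functions with \<open>2 ^ card E\<close> elements, on which the sum of
  the local symplectic forms vanishes (\<open>binary_imp_lagrangian\<close>). Calling a subtransversal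
  independent if no nonzero member of \<open>L\<close> is contained in it gives a tight 3-matroid; as a tight
  3-matroid is determined by its bases that avoid the third transversal
  (\<open>tight_3_matroid_unique\<close>), it is \<open>Z\<^sub>3(D, \<tau>)\<close> (\<open>Z3_eq_ZL\<close>). Duality and loop complementation only
  permute the three nonzero elements of \<open>K\<close> (\<open>dual_sys\<close>, \<open>plus_all_sys\<close>).

  For \<open>v \<in> L\<close> let \<open>n\<^sub>i(v)\<close> be the number of coordinates equal to \<open>i\<close>, modulo 2. As a function on
  all of \<open>E \<rightarrow> K\<close> this is a quadratic form whose polarization is the symplectic form, so it is linear
  on \<open>L\<close>. Then \<open>D\<close> is even iff \<open>n\<^sub>3 = 0\<close> on \<open>L\<close> (\<open>even_sys_iff\<close>): off one coordinate, the
  fundamental circuit of a feasible transversal uses only the values \<open>1\<close> and \<open>2\<close>, and at that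
  coordinate it has the value \<open>3\<close> exactly when changing the feasible set in this one element keeps
  it feasible. Further, \<open>D\<close> is bipartite iff \<open>n\<^sub>2 + n\<^sub>3 = 0\<close> on \<open>L\<close> (\<open>bipartite_sys_iff\<close>): the
  cycle space of \<open>D\<^sub>m\<^sub>i\<^sub>n\<close> consists of the sets \<open>{e. v e \<noteq> 0 \<and> v e \<noteq> 1}\<close> for \<open>v \<in> L\<close>. Finally,
  \<open>D\<close> is \<open>Z\<^sub>3\<close>-bipartite iff \<open>n\<^sub>1 + n\<^sub>2 + n\<^sub>3 = 0\<close> on \<open>L\<close>, because every member of \<open>L\<close> is a disjoint
  union of circuits (\<open>Z3_bipartite_sys_iff\<close>).

  By permuting the labels, the seven properties become the vanishing of the seven nonzero
  combinations of \<open>n\<^sub>1, n\<^sub>2, n\<^sub>3\<close>. These are the points of a Fano plane, and the seven triples are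
  its lines: in each of them the three functionals add up to zero, so if two vanish, so does the
  third.\<close>

section \<open>The Klein four-group as a symplectic plane\<close>

text \<open>Arithmetic of bits is meant in the field; rewriting it to Boolean operations would hide the
  linear structure.\<close>

declare add_bit_eq_xor [simp del] mult_bit_eq_and [simp del]

type_synonym klein = "bit \<times> bit"

text \<open>The symplectic form (the determinant) of the plane over the two-element field.\<close>

definition skew :: "klein \<Rightarrow> klein \<Rightarrow> bit" where
  "skew x y = fst x * snd y + snd x * fst y"

lemma skew_add: "skew (x + y) z = skew x z + skew y z"
  by (simp add: skew_def algebra_simps)

lemma bit_cases: "(x::bit) = 0 \<or> x = 1"
  by (cases x) auto

lemma skew_zero [simp]: "skew 0 y = 0" "skew x 0 = 0" "skew x x = 0"
  by (simp_all add: skew_def zero_prod_def algebra_simps)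

lemma skew_eq_0_iff: "skew x y = 0 \<longleftrightarrow> x = 0 \<or> y = 0 \<or> x = y"
proof (cases x; cases y)
  fix x1 x2 y1 y2 assume "x = (x1, x2)" "y = (y1, y2)"
  then show ?thesis
    by (cases x1; cases x2; cases y1; cases y2) (simp_all add: skew_def zero_prod_def)
qed

lemma klein_add_self [simp]: "x + x = (0::klein)"
  by (cases x) (simp add: zero_prod_def)

lemma klein_add_eq_0_iff [simp]: "x + y = 0 \<longleftrightarrow> x = (y::klein)"
  by (metis add.assoc add.right_neutral klein_add_self add.commute)

definition indicator_bit :: "klein \<Rightarrow> klein \<Rightarrow> bit" where
  "indicator_bit k x = (if x = k then 1 else 0)"

text \<open>For \<open>k = (1, 1)\<close> the indicator is the product of the two coordinates; for the other two values
  it differs from that by a linear form. So it is always a quadratic form with polarization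
  \<^const>\<open>skew\<close>.\<close>

lemma indicator_bit_add:
  assumes "k \<noteq> 0"
  shows "indicator_bit k (x + y) = indicator_bit k x + indicator_bit k y + skew x y"
proof (cases k; cases x; cases y)
  fix k1 k2 x1 x2 y1 y2 assume "k = (k1, k2)" "x = (x1, x2)" "y = (y1, y2)"
  then show ?thesis using assms
    by (cases k1; cases k2; cases x1; cases x2; cases y1; cases y2)
      (simp_all add: skew_def indicator_bit_def zero_prod_def)
qed

lemma klein_exhaust:
  fixes a b x :: klein
  assumes "a \<noteq> 0" "b \<noteq> 0" "a \<noteq> b"
  shows "x = 0 \<or> x = a \<or> x = b \<or> x = a + b"
proof (cases a; cases b; cases x)
  fix k1 k2 x1 x2 y1 y2 assume "a = (k1, k2)" "b = (x1, x2)" "x = (y1, y2)"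
  then show ?thesis using assms
    by (cases k1; cases k2; cases x1; cases x2; cases y1; cases y2)
      (simp_all add: zero_prod_def)
qed

lemma of_nat_bit_eq_0_iff: "(of_nat n :: bit) = 0 \<longleftrightarrow> even n"
  by (induction n) auto

section \<open>Lagrangian spaces\<close>

text \<open>Containment of the subtransversals that the two functions encode. The variant
  \<open>below_off e\<close> ignores the coordinate \<open>e\<close>, so that it describes the candidates for a
  fundamental circuit at \<open>e\<close>.\<close>

definition below :: "('a \<Rightarrow> klein) \<Rightarrow> ('a \<Rightarrow> klein) \<Rightarrow> bool" where
  "below v t \<longleftrightarrow> (\<forall>e. v e = 0 \<or> v e = t e)"

definition below_off :: "'a \<Rightarrow> ('a \<Rightarrow> klein) \<Rightarrow> ('a \<Rightarrow> klein) \<Rightarrow> bool" where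
  "below_off e v t \<longleftrightarrow> (\<forall>f. f \<noteq> e \<longrightarrow> v f = 0 \<or> v f = t f)"

text \<open>A subspace of half the dimension on which the symplectic form vanishes. The dimension enters
  as a cardinality, which is all that the pigeonhole argument in \<open>ex_below_off\<close> needs.\<close>

locale lagrangian =
  fixes E :: "'a set" and L :: "('a \<Rightarrow> klein) set"
  assumes finite_E: "finite E"
    and outside: "v \<in> L \<Longrightarrow> e \<notin> E \<Longrightarrow> v e = 0"
    and add_closed: "u \<in> L \<Longrightarrow> v \<in> L \<Longrightarrow> (\<lambda>e. u e + v e) \<in> L"
    and isotropic: "u \<in> L \<Longrightarrow> v \<in> L \<Longrightarrow> (\<Sum>e\<in>E. skew (u e) (v e)) = 0"
    and card_L: "card L = 2 ^ card E"
begin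

text \<open>Independence of the subtransversal encoded by \<open>t\<close>; for \<open>full\<close> functions (transversals)
  this is the property of being a basis.\<close>

definition free :: "('a \<Rightarrow> klein) \<Rightarrow> bool" where
  "free t \<longleftrightarrow> (\<forall>v\<in>L. below v t \<longrightarrow> v = (\<lambda>_. 0))"

definition full :: "('a \<Rightarrow> klein) \<Rightarrow> bool" where
  "full t \<longleftrightarrow> (\<forall>e\<in>E. t e \<noteq> 0)"

lemma freeD: "free t \<Longrightarrow> v \<in> L \<Longrightarrow> below v t \<Longrightarrow> v = (\<lambda>_. 0)"
  by (simp add: free_def)

lemma free_mono: "free t \<Longrightarrow> below s t \<Longrightarrow> free s"
  unfolding free_def below_def by metis

lemma isotropic_single:
  assumes "u \<in> L" "v \<in> L" "e \<in> E"
    and "\<And>f. f \<in> E \<Longrightarrow> f \<noteq> e \<Longrightarrow> skew (u f) (v f) = 0"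
  shows "skew (u e) (v e) = 0"
proof -
  have "(\<Sum>f\<in>E. skew (u f) (v f)) = skew (u e) (v e) + (\<Sum>f\<in>E - {e}. skew (u f) (v f))"
    using assms finite_E by (simp add: sum.remove)
  then show ?thesis using isotropic[OF assms(1,2)] assms(4) by simp
qed

text \<open>If only two coordinates contribute to the form, their contributions cancel.\<close>

lemma isotropic_pair:
  assumes "u \<in> L" "v \<in> L" "e \<in> E" "f \<in> E" "e \<noteq> f"
    and "\<And>g. g \<in> E \<Longrightarrow> g \<noteq> e \<Longrightarrow> g \<noteq> f \<Longrightarrow> skew (u g) (v g) = 0"
  shows "skew (u e) (v e) = skew (u f) (v f)"
proof -
  let ?g = "\<lambda>f. skew (u f) (v f)"
  have "sum ?g E = ?g e + sum ?g (E - {e})"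
    using assms finite_E by (simp add: sum.remove)
  also have "sum ?g (E - {e}) = ?g f + sum ?g (E - {e} - {f})"
    using assms finite_E by (intro sum.remove) auto
  also have "sum ?g (E - {e} - {f}) = 0"
    using assms(6) by (intro sum.neutral) auto
  finally have "?g e + ?g f = 0" using isotropic[OF assms(1,2)] by simp
  then show ?thesis by (cases "?g e"; cases "?g f") auto
qed

text \<open>Pigeonhole: \<open>2 ^ n\<close> vectors, \<open>2 ^ (n - 1)\<close> values.\<close>

text \<open>Forming \<^const>\<open>skew\<close> with \<open>t\<close> at every coordinate other than \<open>e\<close> leaves only
  \<open>2 ^ (card E - 1)\<close> possible results for the \<open>2 ^ card E\<close> members of \<open>L\<close>. Two of them collide,
  and \<^const>\<open>skew\<close> vanishes only on \<open>0\<close> and on equal arguments, so the sum of those two has the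
  form required.\<close>

lemma ex_below_off:
  assumes "full t" "e \<in> E"
  obtains v where "v \<in> L" "v \<noteq> (\<lambda>_. 0)" "below_off e v t"
proof -
  let ?h = "\<lambda>v. {f \<in> E - {e}. skew (v f) (t f) = 1}"
  have "card (?h ` L) \<le> card (Pow (E - {e}))"
    using finite_E by (intro card_mono) auto
  also have "\<dots> = 2 ^ (card E - 1)"
    using finite_E assms by (simp add: card_Pow)
  also have "\<dots> < card L"
    using card_L assms finite_E by (metis card_gt_0_iff diff_less empty_iff less_one one_less_numeral_iff power_strict_increasing semiring_norm(76))
  finally have "\<not> inj_on ?h L"
    by (rule pigeonhole)
  then obtain u w where uw: "u \<in> L" "w \<in> L" "u \<noteq> w" "?h u = ?h w"
    unfolding inj_on_def by blast
  let ?v = "\<lambda>f. u f + w f"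
  have "below_off e ?v t"
    unfolding below_off_def
  proof (intro allI impI)
    fix f assume "f \<noteq> e"
    show "?v f = 0 \<or> ?v f = t f"
    proof (cases "f \<in> E")
      case True
      have "skew (u f) (t f) = skew (w f) (t f)"
        using uw(4) True \<open>f \<noteq> e\<close> by (smt (verit) DiffI bit_not_one_iff mem_Collect_eq singletonD)
      then have "skew (?v f) (t f) = 0"
        by (cases "skew (w f) (t f)") (auto simp: skew_add)
      then show ?thesis
        using \<open>full t\<close> True unfolding full_def skew_eq_0_iff by blast
    next
      case False
      then show ?thesis using outside[OF uw(1)] outside[OF uw(2)] by simp
    qed
  qed
  moreover have "?v \<noteq> (\<lambda>_. 0)"
    using uw(3) by (metis klein_add_eq_0_iff ext)
  ultimately show thesis
    using that add_closed[OF uw(1,2)] by blast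
qed

lemma below_off_skew:
  assumes "u \<in> L" "v \<in> L" "e \<in> E" "below_off e u t" "below_off e v t"
  shows "skew (u e) (v e) = 0"
  using assms(1-3)
proof (rule isotropic_single)
  fix f assume "f \<in> E" "f \<noteq> e"
  then show "skew (u f) (v f) = 0"
    using assms(4,5) unfolding below_off_def skew_eq_0_iff by metis
qed

text \<open>The fundamental circuit \<open>v\<close> at \<open>e\<close>. It spoils the choice \<open>v e\<close> at \<open>e\<close>, and only this one:
  a second vector \<open>u\<close> that spoils another choice would have
  \<open>skew (u e) (v e) \<noteq> 0\<close>, while all other coordinates contribute nothing to the form.\<close>

lemma fundamental:
  assumes "full t" "e \<in> E" "free (t(e := 0))"
  obtains v where "v \<in> L" "v e \<noteq> 0" "below_off e v t"
    "\<And>y. y \<noteq> 0 \<Longrightarrow> free (t(e := y)) \<longleftrightarrow> y \<noteq> v e"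
proof -
  obtain v where v: "v \<in> L" "v \<noteq> (\<lambda>_. 0)" "below_off e v t"
    using ex_below_off[OF assms(1,2)] .
  have ve: "v e \<noteq> 0"
  proof
    assume "v e = 0"
    then have "below v (t(e := 0))" using v(3) by (simp add: below_def below_off_def)
    then show False using assms(3) v(1,2) freeD by blast
  qed
  have "free (t(e := y)) \<longleftrightarrow> y \<noteq> v e" if "y \<noteq> 0" for y
  proof
    assume *: "free (t(e := y))"
    show "y \<noteq> v e"
    proof
      assume "y = v e"
      then have "below v (t(e := y))" using v(3) by (simp add: below_def below_off_def)
      then show False using * v(1,2) freeD by blast
    qed
  next
    assume y: "y \<noteq> v e"
    show "free (t(e := y))"
      unfolding free_def
    proof (intro ballI impI)
      fix u assume u: "u \<in> L" "below u (t(e := y))"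
      then have off: "below_off e u t" unfolding below_def below_off_def by (metis fun_upd_other)
      have "u e = 0 \<or> u e = y" using u(2) unfolding below_def by (metis fun_upd_same)
      moreover have "skew (u e) (v e) = 0" using below_off_skew[OF u(1) v(1) assms(2) off v(3)] .
      ultimately have "u e = 0" using ve y by (auto simp: skew_eq_0_iff)
      then have "below u (t(e := 0))" using off by (simp add: below_def below_off_def)
      then show "u = (\<lambda>_. 0)" using assms(3) u(1) freeD by blast
    qed
  qed
  with that v(1,3) ve show thesis by blast
qed

lemma free_upd_zero: "free (t(e := x)) \<Longrightarrow> free (t(e := 0))"
  by (rule free_mono) (auto simp: below_def)

lemma free_upd_zero': "free t \<Longrightarrow> free (t(e := 0))"
  by (rule free_mono) (auto simp: below_def)

text \<open>Among the three extensions of a transversal at \<open>e\<close> either none or exactly two are bases, so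
  any one of them is determined by the other two. This is tightness, and it is also the rule by
  which loop complementation modifies feasible sets.\<close>

lemma tight:
  assumes "full t" "e \<in> E" "a \<noteq> 0" "b \<noteq> 0" "a \<noteq> b"
  shows "free (t(e := a + b)) \<longleftrightarrow> free (t(e := a)) \<noteq> free (t(e := b))"
proof (cases "free (t(e := 0))")
  case True
  then obtain v where v: "v e \<noteq> 0" "\<And>y. y \<noteq> 0 \<Longrightarrow> free (t(e := y)) \<longleftrightarrow> y \<noteq> v e"
    using fundamental[OF assms(1,2)] by metis
  have "v e = a \<or> v e = b \<or> v e = a + b" using klein_exhaust[OF assms(3-5)] v(1) by blast
  moreover have "a + b \<noteq> 0" "a + b \<noteq> a" "a + b \<noteq> b" using assms by auto
  ultimately show ?thesis using v(2) assms(3-5) by metis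
next
  case False
  then show ?thesis using free_upd_zero by blast
qed

lemma free_extend:
  assumes "free s" "s e = 0" "e \<in> E" "a \<noteq> 0" "b \<noteq> 0" "a \<noteq> b"
  shows "free (s(e := a)) \<or> free (s(e := b))"
proof (rule ccontr)
  have *: "\<exists>v\<in>L. below_off e v s \<and> v e = x" if dep: "\<not> free (s(e := x))" for x
  proof -
    obtain v where v: "v \<in> L" "below v (s(e := x))" "v \<noteq> (\<lambda>_. 0)"
      using dep unfolding free_def by blast
    have "\<not> below v s" using v freeD[OF assms(1)] by blast
    then have "v e = x" using v(2) unfolding below_def by (metis fun_upd_other fun_upd_same)
    moreover have "below_off e v s" using v(2) unfolding below_def below_off_def by (metis fun_upd_other)
    ultimately show ?thesis using v(1) by blast
  qed
  assume "\<not> (free (s(e := a)) \<or> free (s(e := b)))"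
  then obtain u v where "u \<in> L" "v \<in> L" "below_off e u s" "below_off e v s" "u e = a" "v e = b"
    using * by meson
  then have "skew a b = 0" using below_off_skew assms(3) by metis
  then show False using assms(4-6) skew_eq_0_iff by blast
qed

text \<open>The exchange step behind all parity arguments, a pivot on a principal minor of size two. Here
  \<open>v\<close> and \<open>w\<close> are circuits at \<open>e\<close> and \<open>f\<close>. That \<open>v\<close> meets \<open>t\<close> at \<open>f\<close> forces, by isotropy, that
  \<open>w\<close> meets \<open>t\<close> at \<open>e\<close>. So a vector below the new transversal is orthogonal to \<open>w\<close> only if it
  vanishes at \<open>e\<close>, and then orthogonal to \<open>v\<close> only if it vanishes at \<open>f\<close>; what remains is below
  \<open>t\<close>.\<close>

lemma pivot:
  assumes t: "free t" and ef: "e \<in> E" "f \<in> E" "e \<noteq> f"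
    and v: "v \<in> L" "below_off e v t" "v f \<noteq> 0"
    and w: "w \<in> L" "below_off f w t" "w f \<noteq> 0" "w f \<noteq> t f"
    and x: "x \<noteq> t e"
  shows "free (t(e := x, f := w f))"
proof -
  have vf: "v f = t f" using v(2,3) ef(3) unfolding below_off_def by metis
  have "skew (v e) (w e) = skew (v f) (w f)"
  proof (rule isotropic_pair[OF v(1) w(1) ef])
    fix g assume "g \<noteq> e" "g \<noteq> f"
    then show "skew (v g) (w g) = 0"
      using v(2) w(2) unfolding below_off_def skew_eq_0_iff by metis
  qed
  moreover have "skew (v f) (w f) \<noteq> 0" using v(3) w(3,4) vf by (auto simp: skew_eq_0_iff)
  ultimately have "w e \<noteq> 0" by auto
  then have we: "w e = t e" using w(2) ef(3) unfolding below_off_def by metis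
  show ?thesis
    unfolding free_def
  proof (intro ballI impI)
    fix u assume u: "u \<in> L" "below u (t(e := x, f := w f))"
    have uf: "u f = 0 \<or> u f = w f" and ue: "u e = 0 \<or> u e = x"
      and ug: "\<And>g. g \<noteq> e \<Longrightarrow> g \<noteq> f \<Longrightarrow> u g = 0 \<or> u g = t g"
      using u(2) ef(3) unfolding below_def by (metis fun_upd_other fun_upd_same)+
    have "skew (u e) (w e) = 0"
    proof (rule isotropic_single[OF u(1) w(1) ef(1)])
      fix g assume "g \<noteq> e"
      then show "skew (u g) (w g) = 0"
        using w(2) ug uf unfolding below_off_def skew_eq_0_iff by metis
    qed
    then have ue0: "u e = 0" using ue we \<open>w e \<noteq> 0\<close> x by (auto simp: skew_eq_0_iff)
    have "skew (u f) (v f) = 0"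
    proof (rule isotropic_single[OF u(1) v(1) ef(2)])
      fix g assume "g \<noteq> f"
      then show "skew (u g) (v g) = 0"
        using v(2) ug ue0 unfolding below_off_def skew_eq_0_iff by metis
    qed
    then have "u f = 0" using uf vf v(3) w(4) by (auto simp: skew_eq_0_iff)
    then have "below u t" using ue0 ug unfolding below_def by metis
    then show "u = (\<lambda>_. 0)" using t u(1) freeD by blast
  qed
qed

end

section \<open>Duality, loop complementation and evenness\<close>

text \<open>The transversal by which \<open>X\<close> is tested for feasibility when \<open>a\<close> and \<open>b\<close> play the roles of
  the first and second transversal.\<close>

definition pattern :: "klein \<Rightarrow> klein \<Rightarrow> 'a set \<Rightarrow> 'a \<Rightarrow> klein" where
  "pattern a b X e = (if e \<in> X then b else a)"

lemma pattern_upd: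
  "(pattern a b X)(e := b) = pattern a b (insert e X)"
  "(pattern a b X)(e := a) = pattern a b (X - {e})"
  by (auto simp: pattern_def fun_eq_iff)

lemma odd_card_sym_diff_single:
  assumes "finite X" shows "even (card (sym_diff X {e})) \<longleftrightarrow> odd (card X)"
proof (cases "e \<in> X")
  case True
  then have "sym_diff X {e} = X - {e}" "card X = Suc (card (X - {e}))"
    using assms card.remove[of X e] by auto
  then show ?thesis by simp
next
  case False
  then have "sym_diff X {e} = insert e X" by auto
  then show ?thesis using assms False by simp
qed

context lagrangian
begin

definition sys :: "klein \<Rightarrow> klein \<Rightarrow> 'a set_system" where
  "sys a b = \<lparr>ground = E, feasible = {X. X \<subseteq> E \<and> free (pattern a b X)}\<rparr>"

lemma ground_sys [simp]: "ground (sys a b) = E"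
  by (simp add: sys_def)

lemma feasible_sys: "X \<in> feasible (sys a b) \<longleftrightarrow> X \<subseteq> E \<and> free (pattern a b X)"
  by (simp add: sys_def)

lemma full_pattern: "a \<noteq> 0 \<Longrightarrow> b \<noteq> 0 \<Longrightarrow> full (pattern a b X)"
  by (simp add: full_def pattern_def)

lemma free_cong: "(\<And>e. e \<in> E \<Longrightarrow> s e = t e) \<Longrightarrow> free s \<longleftrightarrow> free t"
  unfolding free_def below_def using outside by metis

text \<open>A basis with values in \<open>{a, b}\<close> is built coordinate by coordinate with \<open>free_extend\<close>.\<close>

lemma ex_feasible:
  assumes "a \<noteq> 0" "b \<noteq> 0" "a \<noteq> b"
  shows "feasible (sys a b) \<noteq> {}"
proof -
  have "\<exists>X\<subseteq>S. free (\<lambda>e. if e \<in> S then pattern a b X e else 0)" if "S \<subseteq> E" for S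
    using finite_subset[OF that finite_E] that
  proof (induction S rule: finite_induct)
    case empty
    then show ?case by (auto simp: free_def below_def)
  next
    case (insert e S)
    then obtain X where X: "X \<subseteq> S" "free (\<lambda>e. if e \<in> S then pattern a b X e else 0)" by auto
    let ?s = "\<lambda>e. if e \<in> S then pattern a b X e else 0"
    have "free (?s(e := a)) \<or> free (?s(e := b))"
      using insert.hyps insert.prems assms by (intro free_extend X) auto
    then show ?case
    proof
      assume *: "free (?s(e := a))"
      have "?s(e := a) = (\<lambda>f. if f \<in> insert e S then pattern a b X f else 0)"
        using insert.hyps X(1) by (auto simp: pattern_def fun_eq_iff)
      with * show ?thesis using X(1) by (intro exI[of _ X]) auto
    next
      assume *: "free (?s(e := b))"
      have "?s(e := b) = (\<lambda>f. if f \<in> insert e S then pattern a b (insert e X) f else 0)"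
        using insert.hyps X(1) by (auto simp: pattern_def fun_eq_iff)
      with * show ?thesis using X(1) by (intro exI[of _ "insert e X"]) auto
    qed
  qed
  then obtain X where X: "X \<subseteq> E" "free (\<lambda>e. if e \<in> E then pattern a b X e else 0)" by blast
  moreover have "free (\<lambda>e. if e \<in> E then pattern a b X e else 0) = free (pattern a b X)"
    by (rule free_cong) simp
  ultimately have "X \<in> feasible (sys a b)" by (simp add: feasible_sys)
  then show ?thesis by blast
qed

lemma dual_sys: "dual (sys a b) = sys b a"
proof -
  have *: "free (pattern a b (E - X)) \<longleftrightarrow> free (pattern b a X)" for X
    by (rule free_cong) (simp add: pattern_def)
  have "X \<in> (\<lambda>F. sym_diff F E) ` feasible (sys a b) \<longleftrightarrow> X \<in> feasible (sys b a)" for X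
  proof
    assume "X \<in> (\<lambda>F. sym_diff F E) ` feasible (sys a b)"
    then obtain F where F: "F \<subseteq> E" "free (pattern a b F)" "X = sym_diff F E"
      by (auto simp: feasible_sys)
    then have "X = E - F" "F = E - (E - F)" by auto
    then show "X \<in> feasible (sys b a)"
      using F *[of "E - F"] by (auto simp: feasible_sys)
  next
    assume X: "X \<in> feasible (sys b a)"
    then have "X = sym_diff (E - X) E" by (auto simp: feasible_sys)
    moreover have "E - X \<in> feasible (sys a b)"
      using X *[of X] by (auto simp: feasible_sys)
    ultimately show "X \<in> (\<lambda>F. sym_diff F E) ` feasible (sys a b)" by blast
  qed
  then show ?thesis by (auto simp: dual_def twist_def sys_def)
qed

text \<open>Loop complementation at \<open>e\<close> replaces the value \<open>b\<close> by the third value \<open>a + b\<close> at \<open>e\<close>, by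
  \<open>tight\<close>. Part of the ground set has been treated after each step of the fold, so the
  induction hypothesis describes a system with mixed values.\<close>

lemma plus_all_sys:
  assumes "a \<noteq> 0" "b \<noteq> 0" "a \<noteq> b"
  shows "plus_all (sys a b) = sys a (a + b)"
proof -
  interpret comp_fun_commute loop_compl by (rule comp_fun_commute_loop_compl)
  let ?t = "\<lambda>S Y e. if e \<in> Y then if e \<in> S then a + b else b else a"
  have ab: "a + b \<noteq> 0" using assms by simp
  have "Finite_Set.fold loop_compl (sys a b) S = \<lparr>ground = E, feasible = {Y. Y \<subseteq> E \<and> free (?t S Y)}\<rparr>"
    if "S \<subseteq> E" for S
    using finite_subset[OF that finite_E] that
  proof (induction S rule: finite_induct)
    case empty
    show ?case by (simp add: sys_def pattern_def[abs_def] cong: if_cong)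
  next
    case (insert e S)
    let ?D = "Finite_Set.fold loop_compl (sys a b) S"
    have feas: "Y \<in> feasible ?D \<longleftrightarrow> Y \<subseteq> E \<and> free (?t S Y)" for Y
      using insert by simp
    have "Y \<in> feasible (loop_compl e ?D) \<longleftrightarrow> Y \<subseteq> E \<and> free (?t (insert e S) Y)" for Y
    proof (cases "e \<in> Y")
      case False
      then have "?t S Y = ?t (insert e S) Y" by auto
      then show ?thesis using False by (simp only: mem_feasible_loop_compl feas) auto
    next
      case True
      let ?s = "?t S Y"
      have "full ?s" using assms ab by (auto simp: full_def)
      then have "free (?s(e := a + b)) \<longleftrightarrow> free (?s(e := a)) \<noteq> free (?s(e := b))"
        using insert.prems assms by (intro tight) auto
      moreover have "?s(e := a + b) = ?t (insert e S) Y" "?s(e := b) = ?s"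
        "?s(e := a) = ?t S (Y - {e})"
        using True insert.hyps by auto
      ultimately show ?thesis using True insert.prems
        by (simp only: mem_feasible_loop_compl feas) auto
    qed
    then have "feasible (loop_compl e ?D) = {Y. Y \<subseteq> E \<and> free (?t (insert e S) Y)}" by blast
    moreover have "ground ?D = E" using insert by simp
    then have "ground (loop_compl e ?D) = E" by (simp add: loop_compl_def)
    ultimately show ?case using insert.hyps by simp
  qed
  from this[OF subset_refl]
  have "plus_all (sys a b) = \<lparr>ground = E, feasible = {Y. Y \<subseteq> E \<and> free (?t E Y)}\<rparr>"
    by (simp add: plus_all_def loop_compl_set_def)
  moreover have "free (?t E Y) = free (pattern a (a + b) Y)" for Y
    by (rule free_cong) (simp add: pattern_def)
  ultimately show ?thesis by (simp add: sys_def)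
qed

definition parity :: "klein \<Rightarrow> ('a \<Rightarrow> klein) \<Rightarrow> bit" where
  "parity k v = (\<Sum>e\<in>E. indicator_bit k (v e))"

text \<open>Isotropy turns the quadratic form of \<open>indicator_bit_add\<close> into a linear one.\<close>

lemma parity_add:
  assumes "k \<noteq> 0" "u \<in> L" "v \<in> L"
  shows "parity k (\<lambda>e. u e + v e) = parity k u + parity k v"
  using isotropic[OF assms(2,3)] by (simp add: parity_def indicator_bit_add assms(1) sum.distrib)

lemma parity_single:
  assumes "e \<in> E" "\<And>f. f \<in> E \<Longrightarrow> f \<noteq> e \<Longrightarrow> v f \<noteq> k"
  shows "parity k v = indicator_bit k (v e)"
proof -
  have "parity k v = indicator_bit k (v e) + (\<Sum>f\<in>E - {e}. indicator_bit k (v f))"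
    unfolding parity_def using assms finite_E by (simp add: sum.remove)
  then show ?thesis using assms(2) by (simp add: indicator_bit_def)
qed

lemma pattern_flip:
  "(pattern a b X)(e := (if e \<in> X then a else b)) = pattern a b (sym_diff X {e})"
  by (auto simp: pattern_def fun_eq_iff)

lemma sym_diff_subset: "X \<subseteq> A \<Longrightarrow> Y \<subseteq> A \<Longrightarrow> sym_diff X Y \<subseteq> A"
  by blast

text \<open>If no two feasible sets differ in exactly one element, then from \<open>X\<close> one can move to any
  feasible set \<open>Y\<close> by changing two elements of the symmetric difference at a time: isolation says
  that at every \<open>e \<in> sym_diff X Y\<close> the fundamental circuit of \<open>X\<close> takes the value that \<open>Y\<close>
  prescribes. As this circuit is not below the transversal of \<open>Y\<close>, it meets the transversal of
  \<open>X\<close> in another such element \<open>f\<close>, and \<open>pivot\<close> applies.\<close>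

lemma even_if_isolated:
  assumes ab: "a \<noteq> 0" "b \<noteq> 0" "a \<noteq> b"
    and iso: "\<And>X e. X \<in> feasible (sys a b) \<Longrightarrow> e \<in> E \<Longrightarrow> sym_diff X {e} \<notin> feasible (sys a b)"
  shows "even_system (sys a b)"
proof -
  have "even (card X) \<longleftrightarrow> even (card Y)"
    if "X \<in> feasible (sys a b)" "Y \<in> feasible (sys a b)" for X Y
    using that
  proof (induction "card (sym_diff X Y)" arbitrary: X rule: less_induct)
    case less
    have sub: "X \<subseteq> E" "Y \<subseteq> E" and fr: "free (pattern a b X)" "free (pattern a b Y)"
      using less.prems by (auto simp: feasible_sys)
    show ?case
    proof (cases "X = Y")
      case False
      then obtain e where e: "e \<in> sym_diff X Y" by blast
      have circ: "\<exists>v\<in>L. below_off g v (pattern a b X) \<and> v g = pattern a b Y g"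
        if "g \<in> sym_diff X Y" for g
      proof -
        have gE: "g \<in> E" using that sub by blast
        obtain v where v: "v \<in> L" "below_off g v (pattern a b X)"
          "\<And>y. y \<noteq> 0 \<Longrightarrow> free ((pattern a b X)(g := y)) \<longleftrightarrow> y \<noteq> v g"
          using fundamental[OF full_pattern[OF ab(1,2)] gE free_upd_zero'[OF fr(1)]] by metis
        have "\<not> free (pattern a b (sym_diff X {g}))"
          using iso[OF less.prems(1) gE] sub gE by (auto simp: feasible_sys)
        then have "\<not> free ((pattern a b X)(g := pattern a b Y g))"
          using that pattern_flip[of a b X g] by (auto simp: pattern_def)
        then show ?thesis using v ab by (metis pattern_def)
      qed
      obtain v where v: "v \<in> L" "below_off e v (pattern a b X)" "v e = pattern a b Y e"
        using circ[OF e] by blast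
      have "v \<noteq> (\<lambda>_. 0)" using v(3) ab by (auto simp: pattern_def fun_eq_iff split: if_splits)
      then have "\<not> below v (pattern a b Y)" using freeD[OF fr(2) v(1)] by blast
      then obtain f where f: "v f \<noteq> 0" "v f \<noteq> pattern a b Y f" unfolding below_def by blast
      have fe: "f \<noteq> e" using f v(3) by auto
      have vf: "v f = pattern a b X f" using v(2) f fe unfolding below_off_def by blast
      have fd: "f \<in> sym_diff X Y" using f(2) vf unfolding pattern_def by (auto split: if_splits)
      obtain w where w: "w \<in> L" "below_off f w (pattern a b X)" "w f = pattern a b Y f"
        using circ[OF fd] by blast
      have "free ((pattern a b X)(e := pattern a b Y e, f := w f))"
        using fr(1) _ _ _ v(1,2) f(1) w(1,2)
      proof (rule pivot)
        show "e \<in> E" "f \<in> E" "e \<noteq> f" using e fd sub fe by blast+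
        show "w f \<noteq> 0" using w(3) ab by (simp add: pattern_def)
        show "w f \<noteq> pattern a b X f" using w(3) f(2) vf by simp
        show "pattern a b Y e \<noteq> pattern a b X e" using e ab by (auto simp: pattern_def)
      qed
      moreover have "(pattern a b X)(e := pattern a b Y e, f := w f)
          = pattern a b (sym_diff (sym_diff X {e}) {f})"
        using e fd w(3) fe by (auto simp: pattern_def fun_eq_iff)
      ultimately have X': "sym_diff (sym_diff X {e}) {f} \<in> feasible (sys a b)"
        using e fd sub by (auto simp: feasible_sys)
      let ?X' = "sym_diff (sym_diff X {e}) {f}"
      have "sym_diff ?X' Y \<subset> sym_diff X Y" using e fd fe by blast
      moreover have "finite (sym_diff X Y)" using sub finite_E by (meson finite_subset sym_diff_subset)
      ultimately have "card (sym_diff ?X' Y) < card (sym_diff X Y)" by (simp add: psubset_card_mono)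
      then have "even (card ?X') \<longleftrightarrow> even (card Y)" using less X' by blast
      moreover have "finite X" using sub(1) finite_E by (rule finite_subset)
      ultimately show ?thesis by (simp add: odd_card_sym_diff_single)
    qed simp
  qed
  then show ?thesis unfolding even_system_def by blast
qed

text \<open>If the parity vanishes, a fundamental circuit cannot take the value \<open>a + b\<close> at its own
  coordinate, so feasible sets are isolated. Conversely, in an even system a fundamental circuit of
  a fixed feasible set takes only the values \<open>0, a, b\<close>; these circuits generate \<open>L\<close>, and the
  parity is linear.\<close>

lemma even_sys_iff:
  assumes ab: "a \<noteq> 0" "b \<noteq> 0" "a \<noteq> b"
  shows "even_system (sys a b) \<longleftrightarrow> (\<forall>v\<in>L. parity (a + b) v = 0)"
proof
  assume zero: "\<forall>v\<in>L. parity (a + b) v = 0"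
  have c: "a + b \<noteq> 0" "a + b \<noteq> a" "a + b \<noteq> b" using ab by auto
  show "even_system (sys a b)"
  proof (rule even_if_isolated[OF ab])
    fix X e assume X: "X \<in> feasible (sys a b)" and e: "e \<in> E"
    show "sym_diff X {e} \<notin> feasible (sys a b)"
    proof
      assume X': "sym_diff X {e} \<in> feasible (sys a b)"
      have fr: "free (pattern a b X)" "free (pattern a b (sym_diff X {e}))"
        using X X' by (auto simp: feasible_sys)
      obtain v where v: "v \<in> L" "v e \<noteq> 0" "below_off e v (pattern a b X)"
        "\<And>y. y \<noteq> 0 \<Longrightarrow> free ((pattern a b X)(e := y)) \<longleftrightarrow> y \<noteq> v e"
        using fundamental[OF full_pattern[OF ab(1,2)] e free_upd_zero'[OF fr(1)]] by metis
      have "(pattern a b X)(e := pattern a b X e) = pattern a b X" by simp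
      then have "v e \<noteq> pattern a b X e" using v(4)[of "pattern a b X e"] fr(1) v(2) by metis
      moreover have "v e \<noteq> (if e \<in> X then a else b)"
        using v(4)[of "v e"] v(2) fr(2) pattern_flip[of a b X e] by metis
      ultimately have "v e = a + b"
        using klein_exhaust[OF ab, of "v e"] v(2) by (auto simp: pattern_def split: if_splits)
      moreover have "v f \<noteq> a + b" if "f \<noteq> e" for f
        using v(3) that c unfolding below_off_def pattern_def by metis
      ultimately have "parity (a + b) v = 1" using parity_single[OF e, of v "a + b"] by (simp add: indicator_bit_def)
      then show False using zero v(1) by simp
    qed
  qed
next
  assume even: "even_system (sys a b)"
  have c: "a + b \<noteq> 0" "a + b \<noteq> a" "a + b \<noteq> b" using ab by auto
  obtain X where X: "X \<in> feasible (sys a b)" using ex_feasible[OF ab] by blast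
  let ?t = "pattern a b X"
  \<comment> \<open>Adding a fundamental circuit at one of these coordinates removes it from this set.\<close>
  let ?M = "\<lambda>v. {e \<in> E. v e \<noteq> 0 \<and> v e \<noteq> ?t e}"
  have fr: "free ?t" "X \<subseteq> E" using X by (auto simp: feasible_sys)
  have "parity (a + b) v = 0" if "v \<in> L" for v
    using that
  proof (induction "card (?M v)" arbitrary: v rule: less_induct)
    case less
    show ?case
    proof (cases "?M v = {}")
      case True
      then have "below v ?t" using outside[OF less.prems] unfolding below_def by blast
      then show ?thesis using freeD[OF fr(1) less.prems] c by (simp add: parity_def indicator_bit_def)
    next
      case False
      then obtain e where e: "e \<in> E" "v e \<noteq> 0" "v e \<noteq> ?t e" by blast
      let ?o = "if e \<in> X then a else b"
      obtain u where u: "u \<in> L" "u e \<noteq> 0" "below_off e u ?t"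
        "\<And>y. y \<noteq> 0 \<Longrightarrow> free (?t(e := y)) \<longleftrightarrow> y \<noteq> u e"
        using fundamental[OF full_pattern[OF ab(1,2)] e(1) free_upd_zero'[OF fr(1)]] by metis
      have "sym_diff X {e} \<notin> feasible (sys a b)"
        using even X fr(2) finite_E odd_card_sym_diff_single[of X e] finite_subset
        unfolding even_system_def by blast
      then have "\<not> free (?t(e := ?o))"
        using fr(2) e(1) pattern_flip[of a b X e] by (auto simp: feasible_sys)
      then have ue: "u e = ?o" using u(4)[of ?o] ab by (auto split: if_splits)
      let ?w = "\<lambda>f. v f + u f"
      have wL: "?w \<in> L" using add_closed less.prems u(1) by blast
      have at: "?w e = 0 \<or> ?w e = ?t e"
        using e(2,3) klein_exhaust[OF ab, of "v e"] ue by (auto simp: pattern_def add.assoc add.commute split: if_splits)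
      have off: "?w f = 0 \<or> ?w f = ?t f" if "f \<noteq> e" "v f = 0 \<or> v f = ?t f" for f
      proof -
        have "u f = 0 \<or> u f = ?t f" using u(3) that(1) unfolding below_off_def by blast
        then show ?thesis using that(2) by auto
      qed
      have "f \<in> ?M v - {e}" if "f \<in> ?M ?w" for f
        using that at off[of f] by (cases "f = e") blast+
      then have "?M ?w \<subset> ?M v" using e by blast
      then have "card (?M ?w) < card (?M v)" using finite_E by (simp add: psubset_card_mono)
      then have "parity (a + b) ?w = 0" using wL by (rule less.hyps)
      moreover have "parity (a + b) u = 0"
      proof -
        have "u f \<noteq> a + b" for f
          using u(3) ue c unfolding below_off_def pattern_def by metis
        then show ?thesis by (simp add: parity_def indicator_bit_def)
      qed
      ultimately show ?thesis using parity_add[OF c(1) less.prems u(1)] by simp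
    qed
  qed
  then show "\<forall>v\<in>L. parity (a + b) v = 0" by blast
qed

end

section \<open>Bipartiteness\<close>

text \<open>Membership in \<open>{0, a}\<close> is the kernel of a homomorphism to the two-element group; the
  hypothesis makes the sum a difference of sets.\<close>

lemma klein_mod_add:
  fixes a x y :: klein
  assumes "a \<noteq> 0" "x \<noteq> 0 \<and> x \<noteq> a \<Longrightarrow> y \<noteq> 0 \<and> y \<noteq> a"
  shows "x + y \<noteq> 0 \<and> x + y \<noteq> a \<longleftrightarrow> (y \<noteq> 0 \<and> y \<noteq> a) \<and> \<not> (x \<noteq> 0 \<and> x \<noteq> a)"
proof (cases a; cases x; cases y)
  fix a1 a2 x1 x2 y1 y2 assume "a = (a1, a2)" "x = (x1, x2)" "y = (y1, y2)"
  then show ?thesis using assms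
    by (cases a1; cases a2; cases x1; cases x2; cases y1; cases y2)
      (simp_all add: zero_prod_def)
qed

text \<open>Splitting off minimal nonempty members writes every member as a disjoint union of them. This
  is used for the cycle space of \<open>D\<^sub>m\<^sub>i\<^sub>n\<close> and for the Lagrangian space itself.\<close>

lemma all_even_iff_minimal_even:
  assumes fin: "\<And>A. A \<in> W \<Longrightarrow> finite A"
    and closed: "\<And>A B. A \<in> W \<Longrightarrow> B \<in> W \<Longrightarrow> A \<subseteq> B \<Longrightarrow> B - A \<in> W"
  shows "(\<forall>A\<in>W. even (card A)) \<longleftrightarrow>
    (\<forall>A\<in>W. A \<noteq> {} \<and> (\<forall>B\<in>W. B \<subset> A \<longrightarrow> B = {}) \<longrightarrow> even (card A))"
proof
  assume min: "\<forall>A\<in>W. A \<noteq> {} \<and> (\<forall>B\<in>W. B \<subset> A \<longrightarrow> B = {}) \<longrightarrow> even (card A)"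
  have "even (card A)" if "A \<in> W" for A
    using that
  proof (induction "card A" arbitrary: A rule: less_induct)
    case less
    show ?case
    proof (cases "A \<noteq> {} \<and> (\<exists>B\<in>W. B \<subset> A \<and> B \<noteq> {})")
      case True
      then obtain B where B: "B \<in> W" "B \<subset> A" "B \<noteq> {}" by blast
      have fA: "finite A" using fin less.prems .
      have "A - B \<subset> A" using B by blast
      then have "even (card B)" "even (card (A - B))"
        using less.hyps B less.prems closed[of B A] fA by (auto simp: psubset_card_mono)
      moreover have "card A = card B + card (A - B)"
        using B fA by (metis card_Diff_subset card_mono finite_subset le_add_diff_inverse psubset_imp_subset)
      ultimately show ?thesis by simp
    next
      case False
      then show ?thesis using min less.prems by auto
    qed
  qed
  then show "\<forall>A\<in>W. even (card A)" by blast
qed blast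

context lagrangian
begin

text \<open>The support of \<open>v\<close> after projection to the quotient of the Klein four-group by \<open>{0, a}\<close>.\<close>

definition supp_mod :: "klein \<Rightarrow> ('a \<Rightarrow> klein) \<Rightarrow> 'a set" where
  "supp_mod a v = {e \<in> E. v e \<noteq> 0 \<and> v e \<noteq> a}"

lemma even_card_supp_mod:
  assumes ab: "a \<noteq> 0" "b \<noteq> 0" "a \<noteq> b"
  shows "even (card (supp_mod a v)) \<longleftrightarrow> parity b v + parity (a + b) v = 0"
proof -
  have "indicator_bit b x + indicator_bit (a + b) x = (if x \<noteq> 0 \<and> x \<noteq> a then 1 else 0)" for x
    using klein_exhaust[OF ab, of x] ab by (auto simp: indicator_bit_def)
  then have "parity b v + parity (a + b) v = (\<Sum>e\<in>E. if v e \<noteq> 0 \<and> v e \<noteq> a then 1 else 0)"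
    by (simp add: parity_def flip: sum.distrib)
  also have "\<dots> = of_nat (card (supp_mod a v))"
    using finite_E by (simp add: supp_mod_def sum.If_cases Int_def)
  finally show ?thesis by (simp add: of_nat_bit_eq_0_iff)
qed

lemma finite_feasible: "X \<in> feasible (sys a b) \<Longrightarrow> finite X"
  using finite_E by (auto simp: feasible_sys intro: finite_subset)

text \<open>Minimality of \<open>B\<close> makes \<open>B - {e}\<close> infeasible, so the fundamental circuit at \<open>e\<close> spoils the
  value \<open>a\<close>.\<close>

lemma min_feasible_fundamental:
  assumes ab: "a \<noteq> 0" "b \<noteq> 0" "a \<noteq> b"
    and B: "B \<in> min_feasible (sys a b)" and e: "e \<in> B"
  obtains v where "v \<in> L" "v e = a" "below_off e v (pattern a b B)"
proof -
  have fB: "B \<in> feasible (sys a b)" using B by (simp add: min_feasible_def)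
  then have fr: "free (pattern a b B)" "e \<in> E" using e by (auto simp: feasible_sys)
  obtain v where v: "v \<in> L" "below_off e v (pattern a b B)"
    "\<And>y. y \<noteq> 0 \<Longrightarrow> free ((pattern a b B)(e := y)) \<longleftrightarrow> y \<noteq> v e"
    using fundamental[OF full_pattern[OF ab(1,2)] fr(2) free_upd_zero'[OF fr(1)]] by metis
  have "card (B - {e}) < card B"
    using e finite_feasible[OF fB] by (rule card_Diff1_less[rotated])
  then have "B - {e} \<notin> feasible (sys a b)"
    using B by (auto simp: min_feasible_def simp del: card_Diff_singleton)
  then have "\<not> free ((pattern a b B)(e := a))"
    using fB by (auto simp: feasible_sys pattern_upd)
  then have "v e = a" using v(3) ab(1) by metis
  with v that show thesis by blast
qed

text \<open>Let \<open>e \<in> supp_mod a v \<subseteq> B\<close> and let \<open>u\<close> be the fundamental circuit of \<open>B\<close> at \<open>e\<close>. It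
  vanishes on \<open>B - {e}\<close>, since otherwise \<open>pivot\<close> would make \<open>B\<close> without two of its elements
  feasible. Then \<open>e\<close> is the only coordinate that contributes to the form of \<open>v\<close> and \<open>u\<close>, which
  contradicts isotropy.\<close>

lemma min_feasible_no_supp_mod:
  assumes ab: "a \<noteq> 0" "b \<noteq> 0" "a \<noteq> b"
    and B: "B \<in> min_feasible (sys a b)" and v: "v \<in> L" "supp_mod a v \<subseteq> B"
  shows "supp_mod a v = {}"
proof (rule ccontr)
  assume "supp_mod a v \<noteq> {}"
  then obtain e where e: "e \<in> E" "v e \<noteq> 0" "v e \<noteq> a" "e \<in> B" using v(2) by (auto simp: supp_mod_def)
  have fB: "B \<in> feasible (sys a b)" using B by (simp add: min_feasible_def)
  then have fr: "free (pattern a b B)" "B \<subseteq> E" by (auto simp: feasible_sys)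
  obtain u where u: "u \<in> L" "u e = a" "below_off e u (pattern a b B)"
    using min_feasible_fundamental[OF ab B e(4)] .
  have off: "u f = 0" if f: "f \<in> B" "f \<noteq> e" for f
  proof (rule ccontr)
    assume uf: "u f \<noteq> 0"
    obtain w where w: "w \<in> L" "w f = a" "below_off f w (pattern a b B)"
      using min_feasible_fundamental[OF ab B f(1)] .
    have "free ((pattern a b B)(e := a, f := w f))"
      using fr(1) e(1) _ _ u(1,3) uf w(1,3)
    proof (rule pivot)
      show "f \<in> E" using f(1) fr(2) by blast
      show "w f \<noteq> 0" "w f \<noteq> pattern a b B f" "a \<noteq> pattern a b B e"
        using w(2) ab f(1) e(4) by (auto simp: pattern_def)
    qed (use f in blast)
    then have "B - {e} - {f} \<in> feasible (sys a b)"
      using fr(2) w(2) by (auto simp: feasible_sys pattern_upd)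
    moreover have "card (B - {e} - {f}) < card B"
      using e(4) finite_feasible[OF fB] by (intro psubset_card_mono) auto
    ultimately show False using B unfolding min_feasible_def by (auto simp: not_le simp del: card_Diff_singleton)
  qed
  have "skew (v e) (u e) = 0"
  proof (rule isotropic_single[OF v(1) u(1) e(1)])
    fix f assume f: "f \<in> E" "f \<noteq> e"
    show "skew (v f) (u f) = 0"
    proof (cases "f \<in> B")
      case True
      then show ?thesis using off f by simp
    next
      case False
      then have "v f = 0 \<or> v f = a" using v(2) f by (auto simp: supp_mod_def)
      moreover have "u f = 0 \<or> u f = a" using u(3) f False unfolding below_off_def pattern_def by metis
      ultimately show ?thesis by (auto simp: skew_eq_0_iff)
    qed
  qed
  then show False using e u(2) ab by (auto simp: skew_eq_0_iff)
qed

text \<open>For the direction from right to left, let \<open>B\<close> be a minimum feasible set that misses as little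
  of \<open>I\<close> as possible. If it misses \<open>e \<in> I\<close>, the support of the fundamental circuit at \<open>e\<close> is not
  contained in \<open>I\<close>, and \<open>pivot\<close> exchanges an element \<open>f\<close> of this support outside \<open>I\<close> for \<open>e\<close>.\<close>

lemma Dmin_indep_sys_iff:
  assumes ab: "a \<noteq> 0" "b \<noteq> 0" "a \<noteq> b"
  shows "I \<in> Dmin_indep (sys a b) \<longleftrightarrow> I \<subseteq> E \<and> (\<forall>v\<in>L. supp_mod a v \<subseteq> I \<longrightarrow> supp_mod a v = {})"
proof
  assume "I \<in> Dmin_indep (sys a b)"
  then obtain B where B: "B \<in> min_feasible (sys a b)" "I \<subseteq> B" by (auto simp: Dmin_indep_def)
  then have "I \<subseteq> E" by (auto simp: min_feasible_def feasible_sys)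
  with B show "I \<subseteq> E \<and> (\<forall>v\<in>L. supp_mod a v \<subseteq> I \<longrightarrow> supp_mod a v = {})"
    using min_feasible_no_supp_mod[OF ab B(1)] by blast
next
  assume I: "I \<subseteq> E \<and> (\<forall>v\<in>L. supp_mod a v \<subseteq> I \<longrightarrow> supp_mod a v = {})"
  have "\<exists>B. B \<in> min_feasible (sys a b)"
  proof -
    obtain X where "X \<in> feasible (sys a b)" using ex_feasible[OF ab] by blast
    from ex_has_least_nat[of "\<lambda>X. X \<in> feasible (sys a b)", OF this, of card]
    show ?thesis by (auto simp: min_feasible_def)
  qed
  then obtain B where B: "B \<in> min_feasible (sys a b)"
    and least: "\<And>B'. B' \<in> min_feasible (sys a b) \<Longrightarrow> card (I - B) \<le> card (I - B')"
    using ex_has_least_nat[of "\<lambda>B. B \<in> min_feasible (sys a b)" _ "\<lambda>B. card (I - B)"] by auto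
  have fB: "B \<in> feasible (sys a b)" using B by (simp add: min_feasible_def)
  then have fr: "free (pattern a b B)" "B \<subseteq> E" by (auto simp: feasible_sys)
  have "I \<subseteq> B"
  proof (rule ccontr)
    assume "\<not> I \<subseteq> B"
    then obtain e where e: "e \<in> I" "e \<notin> B" by blast
    then have eE: "e \<in> E" using I by blast
    obtain v where v: "v \<in> L" "v e \<noteq> 0" "below_off e v (pattern a b B)"
      "\<And>y. y \<noteq> 0 \<Longrightarrow> free ((pattern a b B)(e := y)) \<longleftrightarrow> y \<noteq> v e"
      using fundamental[OF full_pattern[OF ab(1,2)] eE free_upd_zero'[OF fr(1)]] by metis
    have "(pattern a b B)(e := a) = pattern a b B" using e(2) by (auto simp: pattern_def)
    then have ve: "v e \<noteq> a" using v(4)[of a] fr(1) ab(1) by metis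
    then have "supp_mod a v \<noteq> {}" using eE v(2) by (auto simp: supp_mod_def)
    then have "\<not> supp_mod a v \<subseteq> I" using I v(1) by blast
    then obtain f where f: "f \<in> E" "v f \<noteq> 0" "v f \<noteq> a" "f \<notin> I" by (auto simp: supp_mod_def)
    have fe: "f \<noteq> e" using f e by blast
    have fB': "f \<in> B" using f v(3) fe unfolding below_off_def pattern_def by metis
    obtain w where w: "w \<in> L" "w f = a" "below_off f w (pattern a b B)"
      using min_feasible_fundamental[OF ab B fB'] .
    have "free ((pattern a b B)(e := b, f := w f))"
      using fr(1) eE f(1) _ v(1,3) f(2) w(1,3)
    proof (rule pivot)
      show "w f \<noteq> 0" "w f \<noteq> pattern a b B f" "b \<noteq> pattern a b B e"
        using w(2) ab fB' e(2) by (auto simp: pattern_def)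
    qed (use fe in blast)
    then have B': "insert e B - {f} \<in> feasible (sys a b)"
      using fr(2) w(2) eE by (auto simp: feasible_sys pattern_upd)
    have fin: "finite B" using finite_feasible fB .
    have "card (insert e B - {f}) = card B"
      using fin e(2) fB' by (simp add: card_Diff_singleton)
    then have "insert e B - {f} \<in> min_feasible (sys a b)"
      using B B' by (simp add: min_feasible_def del: card_Diff_singleton card_Diff_insert)
    then have "card (I - B) \<le> card (I - (insert e B - {f}))" by (rule least)
    moreover have "I - (insert e B - {f}) \<subset> I - B" using e f(4) by blast
    moreover have "finite (I - B)" using I finite_E by (meson finite_Diff finite_subset)
    ultimately show False by (meson leD psubset_card_mono)
  qed
  then show "I \<in> Dmin_indep (sys a b)" using B by (auto simp: Dmin_indep_def)
qed

text \<open>The circuits of \<open>D\<^sub>m\<^sub>i\<^sub>n\<close> are the minimal nonempty sets \<open>supp_mod a v\<close>, by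
  \<open>Dmin_indep_sys_iff\<close>.\<close>

lemma bipartite_sys_iff:
  assumes ab: "a \<noteq> 0" "b \<noteq> 0" "a \<noteq> b"
  shows "bipartite (sys a b) \<longleftrightarrow> (\<forall>v\<in>L. parity b v + parity (a + b) v = 0)"
proof -
  let ?W = "supp_mod a ` L"
  have sub: "A \<subseteq> E" if "A \<in> ?W" for A using that by (auto simp: supp_mod_def)
  have circ: "C \<in> matroid_circuits E (Dmin_indep (sys a b)) \<longleftrightarrow>
      C \<in> ?W \<and> C \<noteq> {} \<and> (\<forall>B\<in>?W. B \<subset> C \<longrightarrow> B = {})" (is "?l \<longleftrightarrow> ?r") for C
  proof
    assume ?l
    then have C: "C \<subseteq> E" "C \<notin> Dmin_indep (sys a b)" "\<And>C'. C' \<subset> C \<Longrightarrow> C' \<in> Dmin_indep (sys a b)"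
      by (auto simp: matroid_circuits_def)
    then obtain v where v: "v \<in> L" "supp_mod a v \<subseteq> C" "supp_mod a v \<noteq> {}"
      by (auto simp: Dmin_indep_sys_iff[OF ab])
    have small: "B = {}" if "B \<in> ?W" "B \<subset> C" for B
      using C(3)[OF that(2)] that(1) by (auto simp: Dmin_indep_sys_iff[OF ab])
    have "supp_mod a v = C" using v small[of "supp_mod a v"] by blast
    then show ?r using v small by blast
  next
    assume r: ?r
    then have "C \<subseteq> E" using sub by blast
    moreover have "C \<notin> Dmin_indep (sys a b)" using r by (auto simp: Dmin_indep_sys_iff[OF ab])
    moreover have "C' \<in> Dmin_indep (sys a b)" if "C' \<subset> C" for C'
      unfolding Dmin_indep_sys_iff[OF ab] using that r \<open>C \<subseteq> E\<close> by (metis image_eqI psubset_imp_subset subset_psubset_trans subset_trans)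
    ultimately show ?l by (simp add: matroid_circuits_def)
  qed
  have "bipartite (sys a b) \<longleftrightarrow>
      (\<forall>A\<in>?W. A \<noteq> {} \<and> (\<forall>B\<in>?W. B \<subset> A \<longrightarrow> B = {}) \<longrightarrow> even (card A))"
    by (simp only: bipartite_def ground_sys Ball_def circ imp_conjL)
  also have "\<dots> \<longleftrightarrow> (\<forall>A\<in>?W. even (card A))"
  proof (rule all_even_iff_minimal_even[symmetric])
    show "finite A" if "A \<in> ?W" for A using sub[OF that] finite_E by (rule finite_subset)
    fix A B assume "A \<in> ?W" "B \<in> ?W" "A \<subseteq> B"
    then obtain u v where uv: "u \<in> L" "v \<in> L" "A = supp_mod a u" "B = supp_mod a v" by blast
    have *: "u e \<noteq> 0 \<and> u e \<noteq> a \<Longrightarrow> v e \<noteq> 0 \<and> v e \<noteq> a" if "e \<in> E" for e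
      using \<open>A \<subseteq> B\<close> uv that by (auto simp: supp_mod_def)
    have "u e + v e \<noteq> 0 \<and> u e + v e \<noteq> a \<longleftrightarrow> (v e \<noteq> 0 \<and> v e \<noteq> a) \<and> \<not> (u e \<noteq> 0 \<and> u e \<noteq> a)"
      if "e \<in> E" for e
      using klein_mod_add[OF ab(1) *[OF that]] .
    then have "B - A = supp_mod a (\<lambda>e. u e + v e)" unfolding uv supp_mod_def by blast
    then show "B - A \<in> ?W" using add_closed uv by blast
  qed
  finally show ?thesis by (simp add: even_card_supp_mod[OF ab])
qed

end

section \<open>The tight 3-matroid of a Lagrangian space\<close>

text \<open>If no element of \<open>J - I\<close> could be added to \<open>I\<close>, then every subset of \<open>J\<close> would be congruent
  modulo \<open>W\<close> to a subset of \<open>I\<close>. As \<open>J\<close> has more subsets than \<open>I\<close>, two subsets of \<open>J\<close> would be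
  congruent to each other, and their symmetric difference would be a nonempty member of \<open>W\<close>
  inside \<open>J\<close>.\<close>

lemma binary_matroid:
  assumes fin: "finite T" and W: "W \<subseteq> Pow T"
    and closed: "\<And>A B. A \<in> W \<Longrightarrow> B \<in> W \<Longrightarrow> sym_diff A B \<in> W"
  shows "matroid T {I. I \<subseteq> T \<and> (\<forall>A\<in>W. A \<subseteq> I \<longrightarrow> A = {})}"
  unfolding matroid_def
proof (intro conjI ballI allI impI)
  fix I J
  assume "I \<in> {I. I \<subseteq> T \<and> (\<forall>A\<in>W. A \<subseteq> I \<longrightarrow> A = {})}"
    and "J \<in> {I. I \<subseteq> T \<and> (\<forall>A\<in>W. A \<subseteq> I \<longrightarrow> A = {})}"
    and less: "card I < card J"
  then have I: "I \<subseteq> T" "\<And>A. A \<in> W \<Longrightarrow> A \<subseteq> I \<Longrightarrow> A = {}"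
    and J: "J \<subseteq> T" "\<And>A. A \<in> W \<Longrightarrow> A \<subseteq> J \<Longrightarrow> A = {}" by auto
  have finIJ: "finite I" "finite J" using I(1) J(1) fin finite_subset by auto
  show "\<exists>x\<in>J - I. insert x I \<in> {I. I \<subseteq> T \<and> (\<forall>A\<in>W. A \<subseteq> I \<longrightarrow> A = {})}"
  proof (rule ccontr)
    assume no: "\<not> ?thesis"
    have circ: "\<exists>A\<in>W. x \<in> A \<and> A \<subseteq> insert x I" if "x \<in> J" "x \<notin> I" for x
    proof -
      have "insert x I \<subseteq> T" using that I(1) J(1) by blast
      moreover have "x \<in> J - I" using that by blast
      ultimately have "\<not> (\<forall>A\<in>W. A \<subseteq> insert x I \<longrightarrow> A = {})" using no by simp
      then obtain A where A: "A \<in> W" "A \<subseteq> insert x I" "A \<noteq> {}" by blast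
      then have "x \<in> A" using I(2) by blast
      with A show ?thesis by blast
    qed
    have "W \<noteq> {}"
      using less circ by (metis card_mono empty_iff finIJ(1) leD subsetI)
    then have W0: "{} \<in> W" using closed by (metis Diff_cancel Un_absorb all_not_in_conv)
    have "\<exists>A\<in>W. sym_diff K A \<subseteq> I" if "K \<subseteq> J" for K
      using finite_subset[OF that finIJ(2)] that
    proof (induction K rule: finite_induct)
      case empty
      then show ?case using W0 by auto
    next
      case (insert x K)
      then obtain A where A: "A \<in> W" "sym_diff K A \<subseteq> I" by auto
      show ?case
      proof (cases "x \<in> I")
        case True
        then have "sym_diff (insert x K) A \<subseteq> I" using A(2) by blast
        with A(1) show ?thesis by blast
      next
        case False
        then obtain B where B: "B \<in> W" "x \<in> B" "B \<subseteq> insert x I" using circ insert.prems by blast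
        have "sym_diff (insert x K) (sym_diff A B) \<subseteq> I"
          using A(2) B(2,3) insert.hyps False by blast
        with closed[OF A(1) B(1)] show ?thesis by blast
      qed
    qed
    then obtain \<phi> where \<phi>: "\<And>K. K \<subseteq> J \<Longrightarrow> \<phi> K \<in> W" "\<And>K. K \<subseteq> J \<Longrightarrow> sym_diff K (\<phi> K) \<subseteq> I"
      by metis
    let ?h = "\<lambda>K. sym_diff K (\<phi> K)"
    have "card (?h ` Pow J) \<le> card (Pow I)"
      using \<phi>(2) finIJ by (intro card_mono) auto
    also have "\<dots> < card (Pow J)" using less finIJ by (simp add: card_Pow)
    finally have "\<not> inj_on ?h (Pow J)" by (rule pigeonhole)
    then obtain K K' where K: "K \<subseteq> J" "K' \<subseteq> J" "K \<noteq> K'" "?h K = ?h K'"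
      unfolding inj_on_def by blast
    then have "sym_diff K K' = sym_diff (\<phi> K) (\<phi> K')" by blast
    then have "sym_diff K K' \<in> W" using closed \<phi>(1) K(1,2) by metis
    then have "sym_diff K K' = {}" using J(2) K(1,2) by blast
    then show False using K(3) by blast
  qed
qed (use fin in auto)

text \<open>The dictionary between functions with values in the Klein four-group and subtransversals:
  \<open>pt x e\<close> is the element of the skew class of \<open>e\<close> that belongs to the nonzero value \<open>x\<close>, and
  \<open>enc v\<close> is the subtransversal of \<open>v\<close>. The functions considered vanish outside the ground set
  (\<open>vec\<close>), so that they are determined by their encodings.\<close>

locale labelled =
  fixes E :: "'a set" and \<tau> :: "nat \<Rightarrow> 'a \<Rightarrow> 'b"
  assumes finite_ground: "finite E" and labelling: "labelling E \<tau>"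
begin

definition pt :: "klein \<Rightarrow> 'a \<Rightarrow> 'b" where
  "pt x e = \<tau> (if x = (1, 0) then 1 else if x = (0, 1) then 2 else 3) e"

abbreviation U :: "'b set" where "U \<equiv> \<Union>e\<in>E. skew_class \<tau> e"
abbreviation \<Omega> :: "'b set set" where "\<Omega> \<equiv> skew_class \<tau> ` E"

definition vec :: "('a \<Rightarrow> klein) \<Rightarrow> bool" where
  "vec v \<longleftrightarrow> (\<forall>e. e \<notin> E \<longrightarrow> v e = 0)"

definition total :: "('a \<Rightarrow> klein) \<Rightarrow> bool" where
  "total v \<longleftrightarrow> vec v \<and> (\<forall>e\<in>E. v e \<noteq> 0)"

definition enc :: "('a \<Rightarrow> klein) \<Rightarrow> 'b set" where
  "enc v = {pt (v e) e | e. e \<in> E \<and> v e \<noteq> 0}"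

lemma pt_eq_iff:
  assumes "x \<noteq> 0" "y \<noteq> 0" "e \<in> E" "f \<in> E"
  shows "pt x e = pt y f \<longleftrightarrow> x = y \<and> e = f"
proof
  assume eq: "pt x e = pt y f"
  let ?i = "\<lambda>x. if x = (1, 0) then 1 else if x = (0, 1) then 2 else 3 :: nat"
  have "(?i x, e) = (?i y, f)"
    using labelling assms(3,4) eq unfolding labelling_def pt_def
    by (elim inj_onD) auto
  moreover have "?i x = ?i y \<Longrightarrow> x = y"
    using assms(1,2) klein_exhaust[of "(1, 0)" "(0, 1)" x] klein_exhaust[of "(1, 0)" "(0, 1)" y]
    by (auto simp: zero_prod_def split: if_splits)
  ultimately show "x = y \<and> e = f" by simp
qed simp

lemma skew_class_eq: "skew_class \<tau> e = {pt x e | x. x \<noteq> 0}"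
proof -
  have "{x :: klein. x \<noteq> 0} = {(1, 0), (0, 1), (1, 1)}"
    using klein_exhaust[of "(1, 0)" "(0, 1)"] by (auto simp: zero_prod_def)
  then have "{pt x e | x. x \<noteq> 0} = (\<lambda>x. pt x e) ` {(1, 0), (0, 1), (1, 1)}" by blast
  then show ?thesis by (simp add: skew_class_def pt_def)
qed

lemma pt_in_skew_class_iff:
  "x \<noteq> 0 \<Longrightarrow> e \<in> E \<Longrightarrow> f \<in> E \<Longrightarrow> pt x e \<in> skew_class \<tau> f \<longleftrightarrow> e = f"
  using pt_eq_iff unfolding skew_class_eq by blast

lemma pt_in_enc_iff: "x \<noteq> 0 \<Longrightarrow> e \<in> E \<Longrightarrow> pt x e \<in> enc v \<longleftrightarrow> v e = x"
  using pt_eq_iff unfolding enc_def by blast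

lemma enc_subset_U: "enc v \<subseteq> U"
  unfolding enc_def skew_class_eq by blast

lemma enc_subset_iff:
  assumes "vec v" shows "enc v \<subseteq> enc w \<longleftrightarrow> below v w"
proof
  assume sub: "enc v \<subseteq> enc w"
  show "below v w"
    unfolding below_def
  proof
    fix e show "v e = 0 \<or> v e = w e"
    proof (cases "e \<in> E \<and> v e \<noteq> 0")
      case True
      then have "pt (v e) e \<in> enc v" using pt_in_enc_iff by blast
      then have "pt (v e) e \<in> enc w" using sub by blast
      then show ?thesis using pt_in_enc_iff[of "v e" e w] True by simp
    next
      case False
      then show ?thesis using assms by (auto simp: vec_def)
    qed
  qed
next
  assume b: "below v w"
  show "enc v \<subseteq> enc w"
  proof
    fix u assume "u \<in> enc v"
    then obtain e where "e \<in> E" "v e \<noteq> 0" "u = pt (v e) e" by (auto simp: enc_def)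
    moreover from this have "v e = w e" using b unfolding below_def by metis
    ultimately show "u \<in> enc w" using pt_in_enc_iff by metis
  qed
qed

lemma enc_eq_iff: "vec v \<Longrightarrow> vec w \<Longrightarrow> enc v = enc w \<longleftrightarrow> v = w"
proof
  assume vw: "vec v" "vec w" and "enc v = enc w"
  then have "below v w" "below w v" using enc_subset_iff by blast+
  then have "v e = w e" for e unfolding below_def by metis
  then show "v = w" by blast
qed simp

lemma card_enc: "card (enc v) = card {e \<in> E. v e \<noteq> 0}"
proof -
  have "inj_on (\<lambda>e. pt (v e) e) {e \<in> E. v e \<noteq> 0}"
    by (rule inj_onI) (simp add: pt_eq_iff)
  moreover have "enc v = (\<lambda>e. pt (v e) e) ` {e \<in> E. v e \<noteq> 0}" unfolding enc_def by blast
  ultimately show ?thesis by (simp add: card_image)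
qed

lemma finite_enc: "finite (enc v)"
  using finite_ground by (simp add: enc_def)

lemma subtransversal_iff: "subtransversal U \<Omega> S \<longleftrightarrow> (\<exists>v. vec v \<and> S = enc v)"
proof
  assume S: "subtransversal U \<Omega> S"
  have uniq: "x = y" if "e \<in> E" "x \<noteq> 0" "y \<noteq> 0" "pt x e \<in> S" "pt y e \<in> S" for x y e
  proof -
    have "pt x e \<in> S \<inter> skew_class \<tau> e" "pt y e \<in> S \<inter> skew_class \<tau> e"
      using that by (auto simp: pt_in_skew_class_iff)
    then have "pt x e = pt y e" using S that(1) unfolding subtransversal_def by blast
    then show ?thesis using pt_eq_iff that by blast
  qed
  define v where "v e = (if e \<in> E \<and> (\<exists>x. x \<noteq> 0 \<and> pt x e \<in> S) then SOME x. x \<noteq> 0 \<and> pt x e \<in> S else 0)" for e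
  have v: "v e = x" if "e \<in> E" "x \<noteq> 0" "pt x e \<in> S" for e x
  proof -
    have ex: "\<exists>x. x \<noteq> 0 \<and> pt x e \<in> S" using that by blast
    have "v e \<noteq> 0 \<and> pt (v e) e \<in> S" using someI_ex[OF ex] ex that(1) by (simp add: v_def)
    then show ?thesis using uniq that by blast
  qed
  have v': "pt (v e) e \<in> S" if "e \<in> E" "v e \<noteq> 0" for e
  proof -
    have "\<exists>x. x \<noteq> 0 \<and> pt x e \<in> S" using that unfolding v_def by metis
    then show ?thesis using v that(1) by metis
  qed
  have "S = enc v"
  proof
    show "enc v \<subseteq> S" using v' by (auto simp: enc_def)
    show "S \<subseteq> enc v"
    proof
      fix u assume u: "u \<in> S"
      then have "u \<in> U" using S unfolding subtransversal_def by blast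
      then obtain e x where "e \<in> E" "x \<noteq> 0" "u = pt x e" unfolding skew_class_eq by blast
      then show "u \<in> enc v" using v u pt_in_enc_iff by blast
    qed
  qed
  moreover have "vec v" by (simp add: vec_def v_def)
  ultimately show "\<exists>v. vec v \<and> S = enc v" by blast
next
  assume "\<exists>v. vec v \<and> S = enc v"
  then obtain v where S: "S = enc v" by blast
  show "subtransversal U \<Omega> S"
    unfolding subtransversal_def
  proof (intro conjI ballI)
    show "S \<subseteq> U" using enc_subset_U S by blast
    fix \<omega> x y assume "\<omega> \<in> \<Omega>" "x \<in> S \<inter> \<omega>" "y \<in> S \<inter> \<omega>"
    then obtain e where e: "e \<in> E" "x \<in> enc v" "y \<in> enc v" "x \<in> skew_class \<tau> e" "y \<in> skew_class \<tau> e"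
      using S by blast
    then obtain a b where "a \<noteq> 0" "b \<noteq> 0" "x = pt a e" "y = pt b e" unfolding skew_class_eq by blast
    then show "x = y" using e pt_in_enc_iff by metis
  qed
qed

lemma enc_Int_skew_class:
  assumes "e \<in> E"
  shows "enc v \<inter> skew_class \<tau> e = (if v e = 0 then {} else {pt (v e) e})"
proof -
  have "u \<in> enc v \<inter> skew_class \<tau> e \<longleftrightarrow> v e \<noteq> 0 \<and> u = pt (v e) e" for u
  proof
    assume u: "u \<in> enc v \<inter> skew_class \<tau> e"
    then obtain x where "x \<noteq> 0" "u = pt x e" unfolding skew_class_eq by blast
    then show "v e \<noteq> 0 \<and> u = pt (v e) e" using u assms pt_in_enc_iff[of x e v] by auto
  next
    assume "v e \<noteq> 0 \<and> u = pt (v e) e"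
    then show "u \<in> enc v \<inter> skew_class \<tau> e"
      using assms pt_in_enc_iff pt_in_skew_class_iff by blast
  qed
  then show ?thesis by auto
qed

lemma transversal_iff: "transversal U \<Omega> T \<longleftrightarrow> (\<exists>t. total t \<and> T = enc t)"
proof
  assume T: "transversal U \<Omega> T"
  then have "subtransversal U \<Omega> T" unfolding transversal_def subtransversal_def by blast
  then obtain t where t: "vec t" "T = enc t" using subtransversal_iff by blast
  have "t e \<noteq> 0" if "e \<in> E" for e
  proof
    assume "t e = 0"
    then have "T \<inter> skew_class \<tau> e = {}" using enc_Int_skew_class that t(2) by simp
    moreover have "\<exists>x. x \<in> T \<inter> skew_class \<tau> e"
      using T that unfolding transversal_def by (meson ex1_implies_ex imageI)
    ultimately show False by blast
  qed
  then show "\<exists>t. total t \<and> T = enc t" using t by (auto simp: total_def)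
next
  assume "\<exists>t. total t \<and> T = enc t"
  then obtain t where t: "total t" "T = enc t" by blast
  have single: "\<exists>!x. x \<in> T \<inter> \<omega>" if \<omega>: "\<omega> \<in> \<Omega>" for \<omega>
  proof -
    obtain e where "e \<in> E" "\<omega> = skew_class \<tau> e" using \<omega> by blast
    moreover from this have "t e \<noteq> 0" using t(1) by (simp add: total_def)
    ultimately have "T \<inter> \<omega> = {pt (t e) e}" using enc_Int_skew_class t(2) by simp
    then show ?thesis by simp
  qed
  show "transversal U \<Omega> T"
    unfolding transversal_def t(2) using enc_subset_U single[unfolded t(2)] by (intro conjI ballI)
qed

lemma vec_upd: "vec v \<Longrightarrow> e \<in> E \<Longrightarrow> vec (v(e := x))"
  by (auto simp: vec_def)

lemma total_upd: "total v \<Longrightarrow> e \<in> E \<Longrightarrow> x \<noteq> 0 \<Longrightarrow> total (v(e := x))"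
  by (auto simp: total_def vec_def)

lemma enc_upd:
  assumes "e \<in> E" "x \<noteq> 0"
  shows "enc (v(e := x)) = (enc v - skew_class \<tau> e) \<union> {pt x e}"
proof -
  have "u \<in> enc (v(e := x)) \<longleftrightarrow> u \<in> (enc v - skew_class \<tau> e) \<union> {pt x e}" if u: "u \<in> U" for u
  proof -
    obtain f y where "f \<in> E" "y \<noteq> 0" "u = pt y f" using u unfolding skew_class_eq by blast
    then show ?thesis using assms by (auto simp: pt_in_enc_iff pt_in_skew_class_iff pt_eq_iff)
  qed
  moreover have "pt x e \<in> U" using assms unfolding skew_class_eq by blast
  ultimately show ?thesis using enc_subset_U by blast
qed

lemma enc_add_point:
  assumes "e \<in> E" "x \<noteq> 0" "v e = 0"
  shows "enc (v(e := x)) = enc v \<union> {pt x e}"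
  using assms enc_upd enc_Int_skew_class[of e v] by (simp add: Diff_triv)

lemma enc_add_of_below:
  assumes "vec u" "below u v"
  shows "enc (\<lambda>e. v e + u e) = enc v - enc u"
proof -
  have "x \<in> enc (\<lambda>e. v e + u e) \<longleftrightarrow> x \<in> enc v - enc u" if x: "x \<in> U" for x
  proof -
    obtain f y where "f \<in> E" "y \<noteq> 0" "x = pt y f" using x unfolding skew_class_eq by blast
    moreover have "u f = 0 \<or> u f = v f" using assms(2) unfolding below_def by blast
    ultimately show ?thesis by (auto simp: pt_in_enc_iff)
  qed
  then show ?thesis using enc_subset_U by blast
qed

lemma enc_add_below_common:
  assumes "below u t" "below v t"
  shows "enc (\<lambda>e. u e + v e) = sym_diff (enc u) (enc v)"
proof -
  have "x \<in> enc (\<lambda>e. u e + v e) \<longleftrightarrow> x \<in> sym_diff (enc u) (enc v)" if x: "x \<in> U" for x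
  proof -
    obtain f y where "f \<in> E" "y \<noteq> 0" "x = pt y f" using x unfolding skew_class_eq by blast
    moreover have "u f = 0 \<or> u f = t f" "v f = 0 \<or> v f = t f"
      using assms unfolding below_def by blast+
    ultimately show ?thesis by (auto simp: pt_in_enc_iff)
  qed
  then show ?thesis using enc_subset_U by blast
qed

lemma partition_on_classes: "partition_on U \<Omega>"
proof (rule partition_onI)
  show "\<Union> \<Omega> = U" by simp
  show "{} \<notin> \<Omega>" by (auto simp: skew_class_def)
  fix p q assume "p \<in> \<Omega>" "q \<in> \<Omega>" "p \<noteq> q"
  then obtain e f where "e \<in> E" "f \<in> E" "p = skew_class \<tau> e" "q = skew_class \<tau> f" "e \<noteq> f" by blast
  then show "disjnt p q"
    unfolding disjnt_def skew_class_eq using pt_eq_iff by blast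
qed

lemma card_skew_class: "e \<in> E \<Longrightarrow> card (skew_class \<tau> e) = 3"
proof -
  assume e: "e \<in> E"
  have "(1, 0) \<noteq> (0 :: klein)" "(0, 1) \<noteq> (0 :: klein)" "(1, 1) \<noteq> (0 :: klein)"
    by (auto simp: zero_prod_def)
  then have "pt (1, 0) e \<noteq> pt (0, 1) e" "pt (1, 0) e \<noteq> pt (1, 1) e" "pt (0, 1) e \<noteq> pt (1, 1) e"
    using pt_eq_iff e by auto
  then show ?thesis by (simp add: skew_class_def pt_def)
qed

lemma finite_U: "finite U"
  using finite_ground by (simp add: skew_class_def)

definition pattern_on :: "'a set \<Rightarrow> 'a \<Rightarrow> klein" where
  "pattern_on X e = (if e \<in> E then pattern (1, 0) (0, 1) X e else 0)"

lemma total_pattern_on: "total (pattern_on X)"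
  by (simp add: total_def vec_def pattern_on_def pattern_def zero_prod_def)

lemma enc_pattern_on:
  assumes "X \<subseteq> E"
  shows "enc (pattern_on X) = \<tau> 1 ` (E - X) \<union> \<tau> 2 ` X"
proof -
  have "enc (pattern_on X) = (\<lambda>e. pt (pattern_on X e) e) ` (E - X) \<union> (\<lambda>e. pt (pattern_on X e) e) ` X"
    using assms total_pattern_on[of X] unfolding enc_def total_def by blast
  also have "(\<lambda>e. pt (pattern_on X e) e) ` (E - X) = \<tau> 1 ` (E - X)"
    by (rule image_cong) (auto simp: pattern_on_def pattern_def pt_def)
  also have "(\<lambda>e. pt (pattern_on X e) e) ` X = \<tau> 2 ` X"
    using assms by (intro image_cong) (auto simp: pattern_on_def pattern_def pt_def)
  finally show ?thesis .
qed

end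

text \<open>The facts on multimatroids over the given carrier that reduce such a multimatroid to its bases,
  and these to transversals. They are applied to the multimatroid of a Lagrangian space and to any
  competitor in the definition of \<^const>\<open>Z3\<close>.\<close>

locale labelled_multimatroid = labelled +
  fixes Z :: "'b multi_system"
  assumes multimatroid: "multimatroid Z"
    and elements: "elements Z = U" and classes: "classes Z = \<Omega>"
begin

lemma indep_vec: "I \<in> indep Z \<Longrightarrow> \<exists>v. vec v \<and> I = enc v"
  using multimatroid subtransversal_iff unfolding multimatroid_def elements classes by blast

lemma indep_extend:
  assumes "vec v" "enc v \<in> indep Z" "e \<in> E" "v e = 0"
  obtains x where "x \<noteq> 0" "enc (v(e := x)) \<in> indep Z"
proof -
  have ne: "(1, 0) \<noteq> (0 :: klein)" "(0, 1) \<noteq> (0 :: klein)" by (auto simp: zero_prod_def)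
  then have "pt (1, 0) e \<noteq> pt (0, 1) e" using pt_eq_iff assms(3) by auto
  moreover have "pt (1, 0) e \<in> skew_class \<tau> e" "pt (0, 1) e \<in> skew_class \<tau> e"
    using pt_in_skew_class_iff ne assms(3) by auto
  moreover have "skew_class \<tau> e \<inter> enc v = {}" using enc_Int_skew_class[OF assms(3), of v] assms(4) by (simp add: Int_commute)
  moreover have "skew_class \<tau> e \<in> classes Z" using assms(3) classes by simp
  moreover have "\<forall>I\<in>indep Z. \<forall>\<omega>\<in>classes Z. \<forall>x\<in>\<omega>. \<forall>y\<in>\<omega>.
      \<omega> \<inter> I = {} \<and> x \<noteq> y \<longrightarrow> I \<union> {x} \<in> indep Z \<or> I \<union> {y} \<in> indep Z"
    using multimatroid unfolding multimatroid_def by (elim conjE)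
  ultimately have "enc v \<union> {pt (1, 0) e} \<in> indep Z \<or> enc v \<union> {pt (0, 1) e} \<in> indep Z"
    using assms(2) by blast
  then show thesis using that ne enc_add_point[of e _ v] assms(3,4) by metis
qed

text \<open>A basis that misses a skew class could be extended there, because the class has two distinct
  elements; so bases are transversals.\<close>

lemma bases_iff: "B \<in> bases Z \<longleftrightarrow> (\<exists>t. total t \<and> B = enc t \<and> enc t \<in> indep Z)"
proof
  assume B: "B \<in> bases Z"
  then have "B \<in> indep Z" by (simp add: bases_def)
  then obtain v where v: "vec v" "B = enc v" "enc v \<in> indep Z" using indep_vec by blast
  have "v e \<noteq> 0" if e: "e \<in> E" for e
  proof
    assume ve: "v e = 0"
    then obtain x where x: "x \<noteq> 0" "enc (v(e := x)) \<in> indep Z" using indep_extend v e by metis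
    have "enc v \<subseteq> enc (v(e := x))" using enc_add_point[of e x v] e x ve by blast
    then have "enc (v(e := x)) = enc v" using B x(2) v(2) unfolding bases_def by blast
    then have "v(e := x) = v" using enc_eq_iff v(1) vec_upd e by blast
    then show False using ve x(1) by (metis fun_upd_same)
  qed
  then show "\<exists>t. total t \<and> B = enc t \<and> enc t \<in> indep Z" using v by (auto simp: total_def)
next
  assume "\<exists>t. total t \<and> B = enc t \<and> enc t \<in> indep Z"
  then obtain t where t: "total t" "B = enc t" "enc t \<in> indep Z" by blast
  have "I = B" if I: "I \<in> indep Z" "B \<subseteq> I" for I
  proof -
    obtain w where w: "vec w" "I = enc w" using indep_vec I(1) by blast
    then have "below t w" using I(2) t enc_subset_iff by (auto simp: total_def)
    then have "t e = w e" for e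
      using t(1) w(1) unfolding below_def total_def vec_def by metis
    then have "t = w" by blast
    then show ?thesis using w t by simp
  qed
  then show "B \<in> bases Z" using t unfolding bases_def by blast
qed

lemma enc_in_bases_iff: "total t \<Longrightarrow> enc t \<in> bases Z \<longleftrightarrow> enc t \<in> indep Z"
  using bases_iff unfolding bases_def by blast

lemma indep_downward:
  assumes "J \<in> indep Z" "I \<subseteq> J"
  shows "I \<in> indep Z"
proof -
  obtain v where v: "vec v" "J = enc v" using indep_vec assms(1) by blast
  define t where "t e = (if e \<in> E \<and> v e = 0 then (1, 0) else v e)" for e
  have t: "total t" using v(1) by (auto simp: total_def vec_def t_def zero_prod_def)
  have "below v t" by (auto simp: below_def t_def)
  then have "J \<subseteq> enc t" using v enc_subset_iff by blast
  moreover have "matroid (enc t) (indep Z \<inter> Pow (enc t))"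
    using multimatroid t transversal_iff unfolding multimatroid_def elements classes by blast
  ultimately show ?thesis using assms unfolding matroid_def by blast
qed

lemma indep_iff: "I \<in> indep Z \<longleftrightarrow> (\<exists>B\<in>bases Z. I \<subseteq> B)"
proof
  assume I: "I \<in> indep Z"
  have "indep Z \<subseteq> Pow U" using indep_vec enc_subset_U by fastforce
  then have "finite (indep Z)" using finite_U by (meson finite_Pow_iff finite_subset)
  then obtain B where "B \<in> indep Z" "I \<subseteq> B" "\<forall>J\<in>indep Z. B \<subseteq> J \<longrightarrow> J = B"
    using finite_has_maximal2[OF _ I] by metis
  then show "\<exists>B\<in>bases Z. I \<subseteq> B" unfolding bases_def by blast
next
  assume "\<exists>B\<in>bases Z. I \<subseteq> B"
  then show "I \<in> indep Z" using indep_downward unfolding bases_def by blast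
qed

text \<open>An independent transversal is maximal independent both in \<open>Z\<close> and in the deletion that contains
  it.\<close>

lemma feasible_system_of:
  "X \<in> feasible (system_of E \<tau> Z) \<longleftrightarrow> X \<subseteq> E \<and> enc (pattern_on X) \<in> bases Z"
proof -
  have "enc (pattern_on X) \<in> bases (delete Z (\<tau> 3 ` E)) \<longleftrightarrow> enc (pattern_on X) \<in> bases Z"
  proof
    assume "enc (pattern_on X) \<in> bases (delete Z (\<tau> 3 ` E))"
    then have "enc (pattern_on X) \<in> indep Z" by (simp add: bases_def delete_def)
    then show "enc (pattern_on X) \<in> bases Z" using enc_in_bases_iff[OF total_pattern_on] by blast
  next
    assume b: "enc (pattern_on X) \<in> bases Z"
    have "u \<notin> \<tau> 3 ` E" if u: "u \<in> enc (pattern_on X)" for u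
    proof
      assume "u \<in> \<tau> 3 ` E"
      then obtain e where e: "e \<in> E" "u = pt (1, 1) e" by (auto simp: pt_def)
      then have "pattern_on X e = (1, 1)" using u by (simp add: pt_in_enc_iff zero_prod_def)
      then show False by (auto simp: pattern_on_def pattern_def zero_prod_def split: if_splits)
    qed
    then have "enc (pattern_on X) \<subseteq> elements Z - \<tau> 3 ` E" using enc_subset_U elements by blast
    then show "enc (pattern_on X) \<in> bases (delete Z (\<tau> 3 ` E))"
      using b by (simp add: bases_def delete_def)
  qed
  then show ?thesis using enc_pattern_on by (auto simp: system_of_def)
qed

text \<open>The counterpart of \<open>tight\<close> for an arbitrary tight 3-matroid. If one of the three
  transversals is a basis, tightness applies to it and exactly one of the three is not a basis;
  otherwise none is.\<close>

lemma tight_total: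
  assumes "tight_3_matroid Z" "total t" "e \<in> E" "a \<noteq> 0" "b \<noteq> 0" "a \<noteq> b"
  shows "enc (t(e := a + b)) \<in> bases Z \<longleftrightarrow>
    (enc (t(e := a)) \<in> bases Z) \<noteq> (enc (t(e := b)) \<in> bases Z)"
proof -
  have main: "\<exists>x. x \<noteq> 0 \<and> (\<forall>y. y \<noteq> 0 \<longrightarrow> (enc (t(e := y)) \<in> bases Z \<longleftrightarrow> y \<noteq> x))"
    if z: "z \<noteq> 0" "enc (t(e := z)) \<in> bases Z" for z
  proof -
    have step: "enc (t(e := z)) - skew_class \<tau> e \<union> {pt y e} = enc (t(e := y))" if "y \<noteq> 0" for y
      using enc_upd[OF assms(3) that, of "t(e := z)"] by simp
    have "skew_class \<tau> e \<in> classes Z" using assms(3) classes by simp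
    then have "\<exists>!u. u \<in> skew_class \<tau> e \<and> enc (t(e := z)) - skew_class \<tau> e \<union> {u} \<notin> bases Z"
      using assms(1) z(2) unfolding tight_3_matroid_def by blast
    then obtain u where u: "u \<in> skew_class \<tau> e" "enc (t(e := z)) - skew_class \<tau> e \<union> {u} \<notin> bases Z"
      "\<And>u'. u' \<in> skew_class \<tau> e \<Longrightarrow> enc (t(e := z)) - skew_class \<tau> e \<union> {u'} \<notin> bases Z \<Longrightarrow> u' = u"
      by blast
    obtain x where x: "x \<noteq> 0" "u = pt x e" using u(1) unfolding skew_class_eq by blast
    have "enc (t(e := y)) \<in> bases Z \<longleftrightarrow> y \<noteq> x" if y: "y \<noteq> 0" for y
    proof
      assume "enc (t(e := y)) \<in> bases Z"
      then show "y \<noteq> x" using u(2) x(2) step[OF x(1)] by auto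
    next
      assume "y \<noteq> x"
      then have "pt y e \<noteq> u" using x y assms(3) pt_eq_iff by auto
      moreover have "pt y e \<in> skew_class \<tau> e" using y assms(3) pt_in_skew_class_iff by blast
      ultimately show "enc (t(e := y)) \<in> bases Z" using u(3) step[OF y] by metis
    qed
    then show ?thesis using x(1) by blast
  qed
  have c: "a + b \<noteq> 0" "a + b \<noteq> a" "a + b \<noteq> b" using assms(4-6) by auto
  show ?thesis
  proof (cases "\<exists>z. z \<noteq> 0 \<and> enc (t(e := z)) \<in> bases Z")
    case True
    then obtain x where x: "x \<noteq> 0" "\<And>y. y \<noteq> 0 \<Longrightarrow> enc (t(e := y)) \<in> bases Z \<longleftrightarrow> y \<noteq> x"
      using main by blast
    then have "x = a \<or> x = b \<or> x = a + b" using klein_exhaust[OF assms(4-6)] by blast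
    then show ?thesis using x(2)[OF assms(4)] x(2)[OF assms(5)] x(2)[OF c(1)] c assms(6) by metis
  next
    case False
    then show ?thesis using c(1) assms(4,5) by blast
  qed
qed

end

text \<open>By \<open>tight_total\<close>, a transversal with the value \<open>(1, 1)\<close> at \<open>e\<close> is a basis iff exactly one of
  the two transversals that have the values \<open>(1, 0)\<close> and \<open>(0, 1)\<close> there is one. Induction on the
  number of such coordinates reduces everything to the transversals that avoid the third one, and
  these are recorded by the feasible sets.\<close>

lemma (in labelled) tight_3_matroid_unique:
  assumes "tight_3_matroid Z" "elements Z = U" "classes Z = \<Omega>"
    and "tight_3_matroid Z'" "elements Z' = U" "classes Z' = \<Omega>"
    and sys: "system_of E \<tau> Z = system_of E \<tau> Z'"
  shows "Z = Z'"
proof -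
  interpret Z: labelled_multimatroid E \<tau> Z
    using assms by unfold_locales (auto simp: tight_3_matroid_def)
  interpret Z': labelled_multimatroid E \<tau> Z'
    using assms by unfold_locales (auto simp: tight_3_matroid_def)
  have ne: "(1, 0) \<noteq> (0 :: klein)" "(0, 1) \<noteq> (0 :: klein)" "(1, 0) \<noteq> ((0, 1) :: klein)"
    by (auto simp: zero_prod_def)
  have sum: "(1, 0) + (0, 1) = ((1, 1) :: klein)" by simp
  have enc_bases: "enc t \<in> bases Z \<longleftrightarrow> enc t \<in> bases Z'" if "total t" for t
    using that
  proof (induction "card {e \<in> E. t e = (1, 1)}" arbitrary: t rule: less_induct)
    case less
    show ?case
    proof (cases "{e \<in> E. t e = (1, 1)} = {}")
      case True
      let ?X = "{e \<in> E. t e = (0, 1)}"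
      have "t e = pattern_on ?X e" for e
        using True less.prems klein_exhaust[OF ne, of "t e"] sum
        by (auto simp: total_def vec_def pattern_on_def pattern_def)
      then have "t = pattern_on ?X" by blast
      moreover have "?X \<in> feasible (system_of E \<tau> Z) \<longleftrightarrow> ?X \<in> feasible (system_of E \<tau> Z')"
        using sys by simp
      ultimately show ?thesis
        unfolding Z.feasible_system_of Z'.feasible_system_of by auto
    next
      case False
      then obtain e where e: "e \<in> E" "t e = (1, 1)" by blast
      have smaller: "enc (t(e := x)) \<in> bases Z \<longleftrightarrow> enc (t(e := x)) \<in> bases Z'"
        if "x \<noteq> 0" "x \<noteq> (1, 1)" for x
      proof (rule less.hyps)
        have "{f \<in> E. (t(e := x)) f = (1, 1)} \<subset> {f \<in> E. t f = (1, 1)}" using e that(2) by auto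
        then show "card {f \<in> E. (t(e := x)) f = (1, 1)} < card {f \<in> E. t f = (1, 1)}"
          using finite_ground by (simp add: psubset_card_mono)
        show "total (t(e := x))" using total_upd less.prems e(1) that(1) .
      qed
      have t: "t(e := (1, 0) + (0, 1)) = t" using e sum by auto
      show ?thesis
        using Z.tight_total[OF assms(1) less.prems e(1) ne]
          Z'.tight_total[OF assms(4) less.prems e(1) ne] smaller ne
        unfolding t by simp
    qed
  qed
  have "B \<in> bases Z \<longleftrightarrow> B \<in> bases Z'" for B
  proof
    assume B: "B \<in> bases Z"
    then obtain t where "total t" "B = enc t" unfolding Z.bases_iff by blast
    then show "B \<in> bases Z'" using enc_bases B by simp
  next
    assume B: "B \<in> bases Z'"
    then obtain t where "total t" "B = enc t" unfolding Z'.bases_iff by blast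
    then show "B \<in> bases Z" using enc_bases B by simp
  qed
  then have eq: "bases Z = bases Z'" by blast
  have "indep Z = indep Z'" by (rule set_eqI) (simp only: Z.indep_iff Z'.indep_iff eq)
  then show ?thesis using assms by (intro multi_system.equality) auto
qed

locale labelled_lagrangian = lagrangian E L + labelled E \<tau>
  for E :: "'a set" and L :: "('a \<Rightarrow> klein) set" and \<tau> :: "nat \<Rightarrow> 'a \<Rightarrow> 'b"
begin

definition ZL :: "'b multi_system" where
  "ZL = \<lparr>elements = U, classes = \<Omega>, indep = {enc s | s. vec s \<and> free s}\<rparr>"

lemma L_vec: "v \<in> L \<Longrightarrow> vec v"
  using outside by (simp add: vec_def)

lemma enc_indep_ZL_iff: "vec s \<Longrightarrow> enc s \<in> indep ZL \<longleftrightarrow> free s"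
  using enc_eq_iff by (auto simp: ZL_def)

lemma vec_zero: "vec (\<lambda>_. 0)" by (simp add: vec_def)

lemma enc_empty_iff: "vec v \<Longrightarrow> enc v = {} \<longleftrightarrow> v = (\<lambda>_. 0)"
  using enc_eq_iff[OF _ vec_zero, of v] by (simp add: enc_def)

text \<open>The members of \<open>L\<close> below a fixed transversal are closed under symmetric difference, so they
  are the cycle space of a binary matroid.\<close>

lemma matroid_ZL:
  assumes "total t" shows "matroid (enc t) (indep ZL \<inter> Pow (enc t))"
proof -
  let ?W = "{enc v | v. v \<in> L \<and> below v t}"
  have vt: "vec t" using assms by (simp add: total_def)
  have "matroid (enc t) {I. I \<subseteq> enc t \<and> (\<forall>A\<in>?W. A \<subseteq> I \<longrightarrow> A = {})}"
  proof (rule binary_matroid)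
    show "finite (enc t)" by (rule finite_enc)
    show "?W \<subseteq> Pow (enc t)" using enc_subset_iff L_vec by auto
    fix A B assume "A \<in> ?W" "B \<in> ?W"
    then obtain u v where uv: "u \<in> L" "below u t" "A = enc u" "v \<in> L" "below v t" "B = enc v" by blast
    then have "sym_diff A B = enc (\<lambda>e. u e + v e)" using enc_add_below_common by simp
    moreover have "below (\<lambda>e. u e + v e) t"
      unfolding below_def
    proof
      fix e show "u e + v e = 0 \<or> u e + v e = t e"
        using uv(2,5)[unfolded below_def, rule_format, of e] by auto
    qed
    ultimately show "sym_diff A B \<in> ?W" using add_closed[OF uv(1,4)] by blast
  qed
  moreover have "{I. I \<subseteq> enc t \<and> (\<forall>A\<in>?W. A \<subseteq> I \<longrightarrow> A = {})} = indep ZL \<inter> Pow (enc t)"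
  proof -
    have "I \<in> indep ZL \<longleftrightarrow> (\<forall>A\<in>?W. A \<subseteq> I \<longrightarrow> A = {})" if I: "I \<subseteq> enc t" for I
    proof -
      have "subtransversal U \<Omega> (enc t)" using subtransversal_iff vt by blast
      then have "subtransversal U \<Omega> I" using I unfolding subtransversal_def by blast
      then obtain s where s: "vec s" "I = enc s" using subtransversal_iff by blast
      then have st: "below s t" using I enc_subset_iff by blast
      have "(\<forall>A\<in>?W. A \<subseteq> I \<longrightarrow> A = {}) \<longleftrightarrow> (\<forall>v\<in>L. below v t \<and> below v s \<longrightarrow> v = (\<lambda>_. 0))"
        using enc_subset_iff enc_empty_iff L_vec s(2) by (smt (verit) mem_Collect_eq)
      also have "\<dots> \<longleftrightarrow> free s"
        using st unfolding free_def below_def by metis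
      finally show ?thesis using enc_indep_ZL_iff s by simp
    qed
    then show ?thesis by blast
  qed
  ultimately show ?thesis by simp
qed

text \<open>The second axiom is \<open>free_extend\<close>: two circuits that block distinct elements of one skew class
  would not be orthogonal.\<close>

lemma multimatroid_ZL: "multimatroid ZL"
  unfolding multimatroid_def
proof (intro conjI ballI allI impI)
  show "finite (elements ZL)" using finite_U by (simp add: ZL_def)
  show "partition_on (elements ZL) (classes ZL)" using partition_on_classes by (simp add: ZL_def)
next
  fix I assume "I \<in> indep ZL"
  then show "subtransversal (elements ZL) (classes ZL) I"
    using subtransversal_iff by (auto simp: ZL_def)
next
  fix T assume "transversal (elements ZL) (classes ZL) T"
  then have "transversal U \<Omega> T" by (simp add: ZL_def)
  then obtain t where "total t" "T = enc t" unfolding transversal_iff by (elim exE conjE)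
  then show "matroid T (indep ZL \<inter> Pow T)" using matroid_ZL by simp
next
  fix I \<omega> x y
  assume I: "I \<in> indep ZL" and "\<omega> \<in> classes ZL" "x \<in> \<omega>" "y \<in> \<omega>" "\<omega> \<inter> I = {} \<and> x \<noteq> y"
  then obtain e where e: "e \<in> E" "\<omega> = skew_class \<tau> e" by (auto simp: ZL_def)
  obtain a b where ab: "a \<noteq> 0" "b \<noteq> 0" "x = pt a e" "y = pt b e"
    using \<open>x \<in> \<omega>\<close> \<open>y \<in> \<omega>\<close> e(2) unfolding skew_class_eq by blast
  then have "a \<noteq> b" using \<open>\<omega> \<inter> I = {} \<and> x \<noteq> y\<close> by blast
  obtain s where s: "vec s" "free s" "I = enc s" using I by (auto simp: ZL_def)
  have se: "s e = 0"
    using enc_Int_skew_class[OF e(1), of s] \<open>\<omega> \<inter> I = {} \<and> x \<noteq> y\<close> s(3) e(2) by (auto split: if_splits)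
  have "free (s(e := a)) \<or> free (s(e := b))"
    using free_extend s(2) se e(1) ab(1,2) \<open>a \<noteq> b\<close> .
  then show "I \<union> {x} \<in> indep ZL \<or> I \<union> {y} \<in> indep ZL"
    using enc_indep_ZL_iff[OF vec_upd[OF s(1) e(1)]] enc_add_point[of e _ s] e(1) se ab s(3) by metis
qed

sublocale ZL: labelled_multimatroid E \<tau> ZL
  by unfold_locales (simp_all add: multimatroid_ZL, simp_all add: ZL_def)

lemma enc_bases_ZL_iff: "total t \<Longrightarrow> enc t \<in> bases ZL \<longleftrightarrow> free t"
  using ZL.enc_in_bases_iff enc_indep_ZL_iff by (simp add: total_def)

text \<open>In each skew class, the element that spoils the basis is the one on its fundamental circuit.\<close>

lemma tight_ZL: "tight_3_matroid ZL"
  unfolding tight_3_matroid_def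
proof (intro conjI ballI)
  show "multimatroid ZL" by (rule multimatroid_ZL)
  show "card \<omega> = 3" if "\<omega> \<in> classes ZL" for \<omega>
    using that card_skew_class by (auto simp: ZL_def)
  fix X \<omega> assume X: "X \<in> bases ZL" and "\<omega> \<in> classes ZL"
  then obtain e where e: "e \<in> E" "\<omega> = skew_class \<tau> e" by (auto simp: ZL_def)
  obtain t where t: "total t" "X = enc t" using ZL.bases_iff X by blast
  then have fr: "free t" using X enc_bases_ZL_iff by blast
  have "full t" using t(1) by (simp add: total_def full_def)
  then obtain v where v: "v e \<noteq> 0" "\<And>y. y \<noteq> 0 \<Longrightarrow> free (t(e := y)) \<longleftrightarrow> y \<noteq> v e"
    using fundamental e(1) free_upd_zero'[OF fr] by metis
  have *: "(X - \<omega>) \<union> {pt x e} \<in> bases ZL \<longleftrightarrow> x \<noteq> v e" if "x \<noteq> 0" for x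
    using enc_upd[OF e(1) that, of t] enc_bases_ZL_iff[OF total_upd[OF t(1) e(1) that]] v(2)[OF that]
      t(2) e(2) by simp
  show "\<exists>!u. u \<in> \<omega> \<and> (X - \<omega>) \<union> {u} \<notin> bases ZL"
  proof (rule ex1I[of _ "pt (v e) e"])
    show "pt (v e) e \<in> \<omega> \<and> (X - \<omega>) \<union> {pt (v e) e} \<notin> bases ZL"
      using *[OF v(1)] v(1) e pt_in_skew_class_iff by blast
    fix u assume u: "u \<in> \<omega> \<and> (X - \<omega>) \<union> {u} \<notin> bases ZL"
    then obtain x where "x \<noteq> 0" "u = pt x e" using e(2) unfolding skew_class_eq by blast
    then show "u = pt (v e) e" using * u by blast
  qed
qed

lemma system_of_ZL: "system_of E \<tau> ZL = sys (1, 0) (0, 1)"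
proof -
  have "free (pattern_on X) \<longleftrightarrow> free (pattern (1, 0) (0, 1) X)" for X
    by (rule free_cong) (simp add: pattern_on_def)
  then have "X \<in> feasible (system_of E \<tau> ZL) \<longleftrightarrow> X \<in> feasible (sys (1, 0) (0, 1))" for X
    by (simp only: ZL.feasible_system_of enc_bases_ZL_iff[OF total_pattern_on] feasible_sys)
  then have "feasible (system_of E \<tau> ZL) = feasible (sys (1, 0) (0, 1))" by blast
  moreover have "ground (system_of E \<tau> ZL) = E" by (simp add: system_of_def)
  ultimately show ?thesis by (intro set_system.equality) auto
qed

lemma Z3_eq_ZL: "Z3 (sys (1, 0) (0, 1)) \<tau> = ZL"
  unfolding Z3_def
proof (rule the_equality)
  show "tight_3_matroid ZL \<and> elements ZL = (\<Union>e\<in>ground (sys (1, 0) (0, 1)). skew_class \<tau> e) \<and>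
      classes ZL = skew_class \<tau> ` ground (sys (1, 0) (0, 1)) \<and>
      system_of (ground (sys (1, 0) (0, 1))) \<tau> ZL = sys (1, 0) (0, 1)"
    using tight_ZL system_of_ZL by (simp add: ZL_def)
  show "Z = ZL" if "tight_3_matroid Z \<and> elements Z = (\<Union>e\<in>ground (sys (1, 0) (0, 1)). skew_class \<tau> e) \<and>
      classes Z = skew_class \<tau> ` ground (sys (1, 0) (0, 1)) \<and>
      system_of (ground (sys (1, 0) (0, 1))) \<tau> Z = sys (1, 0) (0, 1)" for Z
    using that tight_ZL system_of_ZL ZL.elements ZL.classes
    by (intro tight_3_matroid_unique) auto
qed

lemma circuits_ZL_iff:
  "C \<in> circuits ZL \<longleftrightarrow> C \<in> enc ` L \<and> C \<noteq> {} \<and> (\<forall>B\<in>enc ` L. B \<subset> C \<longrightarrow> B = {})"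
    (is "?l \<longleftrightarrow> ?r")
proof
  assume ?l
  then have C: "subtransversal U \<Omega> C" "C \<notin> indep ZL"
    "\<And>C'. C' \<subset> C \<Longrightarrow> subtransversal U \<Omega> C' \<Longrightarrow> C' \<in> indep ZL"
    by (auto simp: circuits_def ZL_def)
  obtain s where s: "vec s" "C = enc s" using C(1) subtransversal_iff by blast
  then have "\<not> free s" using C(2) enc_indep_ZL_iff by blast
  then obtain v where v: "v \<in> L" "below v s" "v \<noteq> (\<lambda>_. 0)" by (auto simp: free_def)
  have small: "B = {}" if B: "B \<in> enc ` L" "B \<subset> C" for B
  proof -
    obtain w where w: "w \<in> L" "B = enc w" using B(1) by blast
    then have "B \<in> indep ZL" using C(3) B(2) subtransversal_iff L_vec by blast
    then have "free w" using enc_indep_ZL_iff L_vec w by blast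
    moreover have "below w w" by (simp add: below_def)
    ultimately show ?thesis using freeD w enc_empty_iff L_vec by blast
  qed
  have "enc v \<subseteq> C" "enc v \<noteq> {}" using v s enc_subset_iff enc_empty_iff L_vec by auto
  moreover from this have "enc v = C" using small[of "enc v"] v(1) by blast
  ultimately show ?r using small v(1) by blast
next
  assume r: ?r
  then obtain v where v: "v \<in> L" "C = enc v" by blast
  have "v \<noteq> (\<lambda>_. 0)" using r v enc_empty_iff L_vec by blast
  moreover have "below v v" by (simp add: below_def)
  ultimately have "\<not> free v" using v(1) freeD by blast
  then have dep: "C \<notin> indep ZL" using v enc_indep_ZL_iff L_vec by blast
  have "C' \<in> indep ZL" if C': "C' \<subset> C" "subtransversal U \<Omega> C'" for C'
  proof -
    obtain s where s: "vec s" "C' = enc s" using C'(2) subtransversal_iff by blast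
    have "free s"
      unfolding free_def
    proof (intro ballI impI)
      fix w assume w: "w \<in> L" "below w s"
      then have "enc w \<subset> C" using enc_subset_iff L_vec s(2) C'(1) by blast
      then have "enc w = {}" using r w(1) by blast
      then show "w = (\<lambda>_. 0)" using enc_empty_iff L_vec w(1) by blast
    qed
    then show ?thesis using enc_indep_ZL_iff s by blast
  qed
  moreover have "subtransversal U \<Omega> C" using subtransversal_iff v L_vec by blast
  ultimately show ?l using dep unfolding circuits_def ZL.elements ZL.classes by blast
qed

lemma Z3_bipartite_sys_iff:
  "Z3_bipartite (sys (1, 0) (0, 1)) \<tau> \<longleftrightarrow>
    (\<forall>v\<in>L. parity (1, 0) v + parity (0, 1) v + parity (1, 1) v = 0)"
proof -
  have "Z3_bipartite (sys (1, 0) (0, 1)) \<tau> \<longleftrightarrow>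
      (\<forall>A\<in>enc ` L. A \<noteq> {} \<and> (\<forall>B\<in>enc ` L. B \<subset> A \<longrightarrow> B = {}) \<longrightarrow> even (card A))"
    by (simp only: Z3_bipartite_def Z3_eq_ZL Ball_def circuits_ZL_iff imp_conjL)
  also have "\<dots> \<longleftrightarrow> (\<forall>A\<in>enc ` L. even (card A))"
  proof (rule all_even_iff_minimal_even[symmetric])
    show "finite A" if "A \<in> enc ` L" for A using that finite_enc by blast
    fix A B assume "A \<in> enc ` L" "B \<in> enc ` L" "A \<subseteq> B"
    then obtain u v where uv: "u \<in> L" "v \<in> L" "A = enc u" "B = enc v" by blast
    then have "below u v" using \<open>A \<subseteq> B\<close> enc_subset_iff L_vec by blast
    then have "B - A = enc (\<lambda>e. v e + u e)" using enc_add_of_below L_vec uv by simp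
    then show "B - A \<in> enc ` L" using add_closed uv by blast
  qed
  also have "\<dots> \<longleftrightarrow> (\<forall>v\<in>L. parity (1, 0) v + parity (0, 1) v + parity (1, 1) v = 0)"
  proof -
    have ne: "(1, 0) \<noteq> (0 :: klein)" "(0, 1) \<noteq> (0 :: klein)" "(1, 0) \<noteq> ((0, 1) :: klein)"
      by (auto simp: zero_prod_def)
    have "even (card (enc v)) \<longleftrightarrow> parity (1, 0) v + parity (0, 1) v + parity (1, 1) v = 0" for v
    proof -
      have "indicator_bit (1, 0) x + indicator_bit (0, 1) x + indicator_bit (1, 1) x = (if x \<noteq> 0 then 1 else 0)" for x
        using klein_exhaust[OF ne, of x] by (auto simp: indicator_bit_def zero_prod_def)
      then have "parity (1, 0) v + parity (0, 1) v + parity (1, 1) v = (\<Sum>e\<in>E. if v e \<noteq> 0 then 1 else 0)"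
        by (simp add: parity_def flip: sum.distrib)
      also have "\<dots> = of_nat (card (enc v))"
        using finite_E by (simp add: card_enc sum.If_cases Int_def)
      finally show ?thesis by (simp add: of_nat_bit_eq_0_iff)
    qed
    then show ?thesis by simp
  qed
  finally show ?thesis .
qed

end

section \<open>Lagrangian spaces of symmetric matrices\<close>

lemma finite_UNIV_bit: "finite (UNIV :: bit set)"
proof -
  have "(UNIV :: bit set) = {0, 1}" using bit_cases by blast
  then show ?thesis by (metis finite.emptyI finite.insertI)
qed

text \<open>There are finitely many vectors over the two-element field, so an injective matrix is
  surjective. Preimages of the unit vectors are the columns of a right inverse, which by injectivity
  is also a left inverse.\<close>

lemma nonsingular_on_iff_trivial_kernel:
  assumes fin: "finite X"
  shows "nonsingular_on A X \<longleftrightarrow>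
    (\<forall>y. (\<forall>i\<in>X. (\<Sum>k\<in>X. A i k * y k) = 0) \<longrightarrow> (\<forall>k\<in>X. y k = 0))" (is "_ \<longleftrightarrow> ?K")
proof
  assume "nonsingular_on A X"
  then obtain B where B: "\<And>i j. i \<in> X \<Longrightarrow> j \<in> X \<Longrightarrow> (\<Sum>k\<in>X. B i k * A k j) = (if i = j then 1 else 0)"
    unfolding nonsingular_on_def by blast
  show ?K
  proof (intro allI impI ballI)
    fix y j assume y: "\<forall>i\<in>X. (\<Sum>k\<in>X. A i k * y k) = 0" and j: "j \<in> X"
    have "y j = (\<Sum>k\<in>X. (if j = k then 1 else 0) * y k)"
      using fin j by (simp add: if_distrib[of "\<lambda>x. x * _"] cong: if_cong)
    also have "\<dots> = (\<Sum>k\<in>X. (\<Sum>i\<in>X. B j i * A i k) * y k)"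
      using B j by (intro sum.cong) auto
    also have "\<dots> = (\<Sum>k\<in>X. \<Sum>i\<in>X. B j i * (A i k * y k))"
      by (simp add: sum_distrib_right mult.assoc)
    also have "\<dots> = (\<Sum>i\<in>X. \<Sum>k\<in>X. B j i * (A i k * y k))" by (rule sum.swap)
    also have "\<dots> = (\<Sum>i\<in>X. B j i * (\<Sum>k\<in>X. A i k * y k))" by (simp add: sum_distrib_left)
    also have "\<dots> = 0" using y by simp
    finally show "y j = 0" .
  qed
next
  assume K: ?K
  let ?S = "PiE X (\<lambda>_. UNIV :: bit set)"
  let ?F = "\<lambda>y. restrict (\<lambda>i. \<Sum>k\<in>X. A i k * y k) X"
  have surj: "?F ` ?S = ?S"
  proof (rule endo_inj_surj)
    show "finite ?S" using fin finite_UNIV_bit by (intro finite_PiE) auto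
    show "?F ` ?S \<subseteq> ?S" by auto
    show "inj_on ?F ?S"
    proof (rule inj_onI)
      fix y z assume yz: "y \<in> ?S" "z \<in> ?S" "?F y = ?F z"
      have "(\<Sum>k\<in>X. A i k * (y k + z k)) = 0" if "i \<in> X" for i
      proof -
        have "(\<Sum>k\<in>X. A i k * y k) = (\<Sum>k\<in>X. A i k * z k)"
          using fun_cong[OF yz(3), of i] that by simp
        then show ?thesis by (simp add: distrib_left sum.distrib)
      qed
      then have "\<forall>k\<in>X. y k + z k = 0" using K[THEN spec, of "\<lambda>k. y k + z k"] by blast
      then have "y k = z k" if "k \<in> X" for k
        using that by (cases "y k"; cases "z k") auto
      then show "y = z" using PiE_ext yz(1,2) by metis
    qed
  qed
  let ?d = "\<lambda>j. restrict (\<lambda>i. if i = j then 1 else 0 :: bit) X"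
  have "\<exists>y. ?F y = ?d j" for j
  proof -
    have "?d j \<in> ?S" by auto
    then have "?d j \<in> ?F ` ?S" unfolding surj .
    then show ?thesis by (elim imageE) (rule exI, rule sym)
  qed
  then have c: "?F (SOME y. ?F y = ?d j) = ?d j" for j by (rule someI_ex)
  define c where "c j = (SOME y. ?F y = ?d j)" for j
  note c = c[folded c_def]
  have right: "(\<Sum>k\<in>X. A i k * c j k) = (if i = j then 1 else 0)" if "i \<in> X" for i j
    using fun_cong[OF c[of j], of i] that by simp
  have left: "(\<Sum>k\<in>X. c k i * A k j) = (if i = j then 1 else 0)" if ij: "i \<in> X" "j \<in> X" for i j
  proof -
    \<comment> \<open>This is column \<open>j\<close> of the product of the right inverse with \<open>A\<close>, minus the unit vector; it lies in the kernel of \<open>A\<close>.\<close>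
    define z where "z i = (\<Sum>k\<in>X. c k i * A k j) + (if i = j then 1 else 0)" for i
    have "(\<Sum>k\<in>X. A m k * z k) = 0" if m: "m \<in> X" for m
    proof -
      have "(\<Sum>k\<in>X. A m k * (\<Sum>l\<in>X. c l k * A l j)) = (\<Sum>k\<in>X. \<Sum>l\<in>X. A m k * c l k * A l j)"
        by (simp add: sum_distrib_left mult.assoc)
      also have "\<dots> = (\<Sum>l\<in>X. \<Sum>k\<in>X. A m k * c l k * A l j)" by (rule sum.swap)
      also have "\<dots> = (\<Sum>l\<in>X. (\<Sum>k\<in>X. A m k * c l k) * A l j)" by (simp add: sum_distrib_right)
      also have "\<dots> = (\<Sum>l\<in>X. (if m = l then 1 else 0) * A l j)" using right m by simp
      also have "\<dots> = A m j" using fin m by (simp add: if_distrib[of "\<lambda>x. x * _"] cong: if_cong)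
      finally have 1: "(\<Sum>k\<in>X. A m k * (\<Sum>l\<in>X. c l k * A l j)) = A m j" .
      have 2: "(\<Sum>k\<in>X. A m k * (if k = j then 1 else 0)) = A m j"
        using fin ij(2) by (simp add: if_distrib[of "\<lambda>x. _ * x"] cong: if_cong)
      show ?thesis unfolding z_def distrib_left sum.distrib 1 2 by simp
    qed
    then have "z i = 0" using K[THEN spec, of z] ij(1) by blast
    then show ?thesis unfolding z_def by (cases "\<Sum>k\<in>X. c k i * A k j") (auto split: if_splits)
  qed
  show "nonsingular_on A X"
    unfolding nonsingular_on_def by (rule exI[of _ "\<lambda>k j. c j k"]) (use left right in auto)
qed

text \<open>Isomorphic set systems have matrices that differ by a relabelling of rows and columns.\<close>

lemma nonsingular_on_reindex:
  assumes "finite X" "inj_on \<phi> X"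
  shows "nonsingular_on A (\<phi> ` X) \<longleftrightarrow> nonsingular_on (\<lambda>i j. A (\<phi> i) (\<phi> j)) X"
proof -
  have s: "(\<Sum>k\<in>\<phi> ` X. f k) = (\<Sum>k\<in>X. f (\<phi> k))" for f :: "_ \<Rightarrow> bit"
    using assms(2) by (simp add: sum.reindex)
  have "(\<forall>y. (\<forall>i\<in>X. (\<Sum>k\<in>X. A (\<phi> i) (\<phi> k) * y (\<phi> k)) = 0) \<longrightarrow> (\<forall>k\<in>X. y (\<phi> k) = 0)) \<longleftrightarrow>
    (\<forall>y. (\<forall>i\<in>X. (\<Sum>k\<in>X. A (\<phi> i) (\<phi> k) * y k) = 0) \<longrightarrow> (\<forall>k\<in>X. y k = 0))" (is "?l \<longleftrightarrow> ?r")
  proof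
    assume l: ?l
    show ?r
    proof (intro allI impI)
      fix y assume y: "\<forall>i\<in>X. (\<Sum>k\<in>X. A (\<phi> i) (\<phi> k) * y k) = 0"
      let ?y = "\<lambda>k. y (the_inv_into X \<phi> k)"
      have inv: "?y (\<phi> k) = y k" if "k \<in> X" for k
        using the_inv_into_f_f[OF assms(2) that] by simp
      then have "\<forall>i\<in>X. (\<Sum>k\<in>X. A (\<phi> i) (\<phi> k) * ?y (\<phi> k)) = 0" using y by simp
      then have "\<forall>k\<in>X. ?y (\<phi> k) = 0" using l[THEN spec, of ?y] by blast
      then show "\<forall>k\<in>X. y k = 0" using inv by simp
    qed
  next
    assume r: ?r
    show ?l
    proof
      fix y
      show "(\<forall>i\<in>X. (\<Sum>k\<in>X. A (\<phi> i) (\<phi> k) * y (\<phi> k)) = 0) \<longrightarrow> (\<forall>k\<in>X. y (\<phi> k) = 0)"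
        using r[THEN spec, of "\<lambda>k. y (\<phi> k)"] .
    qed
  qed
  then show ?thesis
    using assms by (simp add: nonsingular_on_iff_trivial_kernel s)
qed

text \<open>The graph of a symmetric matrix, the set of all pairs \<open>(A y, y)\<close>, is Lagrangian: isotropy is
  symmetry of \<open>A\<close>. A twist by \<open>X0\<close> exchanges the two coordinates at the elements of \<open>X0\<close>, which
  respects the symplectic form.\<close>

locale twisted_matrix =
  fixes E :: "'a set" and A :: "'a \<Rightarrow> 'a \<Rightarrow> bit" and X0 :: "'a set"
  assumes finite_index: "finite E" and symmetric: "\<And>i j. i \<in> E \<Longrightarrow> j \<in> E \<Longrightarrow> A i j = A j i"
begin

definition mul :: "('a \<Rightarrow> bit) \<Rightarrow> 'a \<Rightarrow> bit" where
  "mul y e = (\<Sum>k\<in>E. A e k * y k)"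

definition graph_vec :: "('a \<Rightarrow> bit) \<Rightarrow> 'a \<Rightarrow> klein" where
  "graph_vec y e =
    (if e \<in> E then if e \<in> X0 then (y e, mul y e) else (mul y e, y e) else 0)"

definition fns :: "('a \<Rightarrow> bit) set" where
  "fns = {y. \<forall>e. e \<notin> E \<longrightarrow> y e = 0}"

definition graph :: "('a \<Rightarrow> klein) set" where
  "graph = graph_vec ` fns"

lemma mul_add: "mul (\<lambda>e. y e + z e) e = mul y e + mul z e"
  by (simp add: mul_def distrib_left sum.distrib)

lemma graph_vec_add: "graph_vec (\<lambda>e. y e + z e) e = graph_vec y e + graph_vec z e"
  by (simp add: graph_vec_def mul_add)

lemma graph_vec_eq_iff:
  assumes "y \<in> fns" "z \<in> fns" shows "graph_vec y = graph_vec z \<longleftrightarrow> y = z"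
proof
  assume eq: "graph_vec y = graph_vec z"
  have "y e = z e" for e
    using fun_cong[OF eq, of e] assms by (auto simp: graph_vec_def fns_def split: if_splits)
  then show "y = z" by blast
qed simp

lemma card_fns: "card fns = 2 ^ card E"
proof -
  have "bij_betw (\<lambda>Y e. if e \<in> Y then 1 else 0 :: bit) (Pow E) fns"
  proof (rule bij_betwI[where g = "\<lambda>y. {e. y e = 1}"])
    show "(\<lambda>Y e. if e \<in> Y then 1 else 0 :: bit) \<in> Pow E \<rightarrow> fns" by (auto simp: fns_def)
    show "(\<lambda>y. {e. y e = 1}) \<in> fns \<rightarrow> Pow E"
      unfolding fns_def using bit_not_one_iff by blast
    show "{e. (if e \<in> Y then 1 else 0 :: bit) = 1} = Y" for Y :: "'a set" by auto
    show "(\<lambda>e. if e \<in> {e. y e = 1} then 1 else 0) = y" for y :: "'a \<Rightarrow> bit" by auto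
  qed
  then show ?thesis using bij_betw_same_card finite_index by (metis card_Pow)
qed

sublocale lagrangian E graph
proof
  show "finite E" by (rule finite_index)
  show "v e = 0" if "v \<in> graph" "e \<notin> E" for v e
    using that by (auto simp: graph_def graph_vec_def)
  show "card graph = 2 ^ card E"
    unfolding graph_def using graph_vec_eq_iff card_fns by (metis card_image inj_onI)
next
  fix u v assume "u \<in> graph" "v \<in> graph"
  then obtain y z where yz: "y \<in> fns" "z \<in> fns" "u = graph_vec y" "v = graph_vec z"
    by (auto simp: graph_def)
  have "(\<lambda>e. y e + z e) \<in> fns" using yz by (simp add: fns_def)
  moreover have "(\<lambda>e. u e + v e) = graph_vec (\<lambda>e. y e + z e)"
    by (rule ext) (simp only: yz graph_vec_add)
  ultimately show "(\<lambda>e. u e + v e) \<in> graph" by (simp add: graph_def)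
  have "(\<Sum>e\<in>E. y e * mul z e) = (\<Sum>e\<in>E. \<Sum>k\<in>E. y e * (A e k * z k))"
    by (simp add: mul_def sum_distrib_left)
  also have "\<dots> = (\<Sum>k\<in>E. \<Sum>e\<in>E. y e * (A e k * z k))" by (rule sum.swap)
  also have "\<dots> = (\<Sum>k\<in>E. \<Sum>e\<in>E. A k e * y e * z k)"
    using symmetric by (intro sum.cong) (auto simp: mult_ac)
  also have "\<dots> = (\<Sum>k\<in>E. mul y k * z k)" by (simp add: mul_def sum_distrib_right)
  finally have eq: "(\<Sum>e\<in>E. y e * mul z e) = (\<Sum>k\<in>E. mul y k * z k)" .
  have "(\<Sum>e\<in>E. skew (u e) (v e)) = (\<Sum>e\<in>E. mul y e * z e + y e * mul z e)"
    unfolding yz by (intro sum.cong) (auto simp: skew_def graph_vec_def add.commute)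
  then show "(\<Sum>e\<in>E. skew (u e) (v e)) = 0" by (simp add: sum.distrib eq)
qed

text \<open>A vector of the graph is below the transversal of \<open>F\<close> iff \<open>y\<close> is supported on
  \<open>sym_diff F X0\<close> and lies in the kernel of that principal submatrix.\<close>

lemma below_pattern_iff:
  "below (graph_vec y) (pattern (1, 0) (0, 1) F) \<longleftrightarrow>
    (\<forall>e\<in>E. if e \<in> sym_diff F X0 then mul y e = 0 else y e = 0)"
proof -
  have "(graph_vec y e = 0 \<or> graph_vec y e = pattern (1, 0) (0, 1) F e) \<longleftrightarrow>
    (e \<in> E \<longrightarrow> (if e \<in> sym_diff F X0 then mul y e = 0 else y e = 0))" for e
    by (cases "y e"; cases "mul y e"; cases "e \<in> F"; cases "e \<in> X0")
      (simp_all add: graph_vec_def pattern_def zero_prod_def)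
  then show ?thesis unfolding below_def by blast
qed

lemma graph_vec_eq_zero_iff: "y \<in> fns \<Longrightarrow> graph_vec y = (\<lambda>_. 0) \<longleftrightarrow> (\<forall>e\<in>E. y e = 0)"
proof -
  assume y: "y \<in> fns"
  have "(\<lambda>_. 0) \<in> fns" "graph_vec (\<lambda>_. 0) = (\<lambda>_. 0)"
    by (auto simp: fns_def graph_vec_def mul_def zero_prod_def)
  then have "graph_vec y = (\<lambda>_. 0) \<longleftrightarrow> y = (\<lambda>_. 0)" using graph_vec_eq_iff[OF y] by metis
  then show ?thesis using y by (auto simp: fns_def)
qed

lemma free_pattern_iff_nonsingular:
  assumes "F \<subseteq> E" "X0 \<subseteq> E"
  shows "free (pattern (1, 0) (0, 1) F) \<longleftrightarrow> nonsingular_on A (sym_diff F X0)"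
proof -
  define G where G_eq: "G = sym_diff F X0"
  have G: "G \<subseteq> E" using assms unfolding G_eq by blast
  then have finG: "finite G" using finite_index by (rule finite_subset)
  have mul_G: "mul y e = (\<Sum>k\<in>G. A e k * y k)" if "\<And>k. k \<in> E - G \<Longrightarrow> y k = 0" for y e
    unfolding mul_def using finite_index G that by (intro sum.mono_neutral_right) auto
  have "free (pattern (1, 0) (0, 1) F) \<longleftrightarrow>
    (\<forall>y\<in>fns. (\<forall>e\<in>E. if e \<in> G then mul y e = 0 else y e = 0) \<longrightarrow> (\<forall>e\<in>E. y e = 0))"
  proof -
    have "free (pattern (1, 0) (0, 1) F) \<longleftrightarrow>
        (\<forall>y\<in>fns. below (graph_vec y) (pattern (1, 0) (0, 1) F) \<longrightarrow> graph_vec y = (\<lambda>_. 0))"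
      unfolding free_def by (simp add: graph_def)
    then show ?thesis by (simp only: below_pattern_iff graph_vec_eq_zero_iff G_eq cong: ball_cong)
  qed
  also have "\<dots> \<longleftrightarrow> (\<forall>y. (\<forall>i\<in>G. (\<Sum>k\<in>G. A i k * y k) = 0) \<longrightarrow> (\<forall>k\<in>G. y k = 0))"
    (is "?l \<longleftrightarrow> ?r")
  proof
    assume l: ?l
    show ?r
    proof (intro allI impI)
      fix y assume y: "\<forall>i\<in>G. (\<Sum>k\<in>G. A i k * y k) = 0"
      define z where "z k = (if k \<in> G then y k else 0)" for k
      have z0: "z k = 0" if "k \<notin> G" for k using that by (simp add: z_def)
      have "mul z e = (\<Sum>k\<in>G. A e k * y k)" for e
        using mul_G[of z e] z0 by (simp add: z_def)
      then have "if e \<in> G then mul z e = 0 else z e = 0" for e using y z0[of e] by (simp split: if_splits)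
      then have "\<forall>e\<in>E. if e \<in> G then mul z e = 0 else z e = 0" by blast
      moreover have "z \<in> fns" using z0 G by (auto simp: fns_def)
      ultimately have "\<forall>e\<in>E. z e = 0" using l by blast
      then have "\<forall>k\<in>G. z k = 0" using G by blast
      then show "\<forall>k\<in>G. y k = 0" by (simp add: z_def)
    qed
  next
    assume r: ?r
    show ?l
    proof (intro ballI impI)
      fix y e
      assume y: "\<forall>e\<in>E. if e \<in> G then mul y e = 0 else y e = 0" and e: "e \<in> E"
      have y0: "y k = 0" if "k \<in> E - G" for k using y that by (metis DiffD1 DiffD2)
      have "(\<Sum>k\<in>G. A i k * y k) = 0" if i: "i \<in> G" for i
      proof -
        have "i \<in> E" using G i by blast
        then have "mul y i = 0" using bspec[OF y, of i] i by (simp only: if_True)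
        then show ?thesis using mul_G[of y i, OF y0] by simp
      qed
      then have "\<forall>k\<in>G. y k = 0" using r[THEN spec, of y] by blast
      then show "y e = 0" using y0 e by blast
    qed
  qed
  also have "\<dots> \<longleftrightarrow> nonsingular_on A G" by (rule nonsingular_on_iff_trivial_kernel[OF finG, symmetric])
  finally show ?thesis unfolding G_eq .
qed

end

lemma binary_imp_lagrangian:
  fixes D :: "'a set_system"
  assumes "finite (ground D)" "feasible D \<subseteq> Pow (ground D)" "binary D"
  obtains L where "lagrangian (ground D) L" "D = lagrangian.sys (ground D) L (1, 0) (0, 1)"
proof -
  let ?E = "ground D"
  obtain X0 E' and A :: "'a \<Rightarrow> 'a \<Rightarrow> bit" where X0: "X0 \<subseteq> ?E" and E': "finite E'" "\<forall>i\<in>E'. \<forall>j\<in>E'. A i j = A j i"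
    and iso: "set_system_iso (twist D X0) (matrix_system E' A)"
    using assms(3) unfolding binary_def by blast
  then obtain \<phi> where \<phi>: "bij_betw \<phi> ?E E'"
    and feas: "{X. X \<subseteq> E' \<and> nonsingular_on A X} = (\<lambda>F. \<phi> ` F) ` (\<lambda>F. sym_diff F X0) ` feasible D"
    unfolding set_system_iso_def by (auto simp: twist_def matrix_system_def)
  let ?A = "\<lambda>i j. A (\<phi> i) (\<phi> j)"
  interpret twisted_matrix ?E ?A X0
    using assms(1) E'(2) \<phi> by unfold_locales (auto simp: bij_betw_def)
  have "F \<in> feasible D \<longleftrightarrow> F \<subseteq> ?E \<and> free (pattern (1, 0) (0, 1) F)" for F
  proof (cases "F \<subseteq> ?E")
    case True
    let ?G = "sym_diff F X0"
    have G: "?G \<subseteq> ?E" using True X0 by blast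
    have inj: "inj_on \<phi> ?E" "\<phi> ` ?G \<subseteq> E'" using \<phi> G by (auto simp: bij_betw_def)
    have "F \<in> feasible D \<longleftrightarrow> \<phi> ` ?G \<in> (\<lambda>F. \<phi> ` F) ` (\<lambda>F. sym_diff F X0) ` feasible D"
    proof
      assume "\<phi> ` ?G \<in> (\<lambda>F. \<phi> ` F) ` (\<lambda>F. sym_diff F X0) ` feasible D"
      then obtain F' where F': "F' \<in> feasible D" "\<phi> ` ?G = \<phi> ` sym_diff F' X0" by blast
      have "sym_diff F' X0 \<subseteq> ?E" using F'(1) assms(2) X0 by blast
      then have "?G = sym_diff F' X0" using inj_on_image_eq_iff[OF inj(1) G] F'(2) by blast
      then have "F = F'" by blast
      then show "F \<in> feasible D" using F'(1) by simp
    qed blast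
    also have "\<dots> \<longleftrightarrow> nonsingular_on A (\<phi> ` ?G)" unfolding feas[symmetric] using inj(2) by blast
    also have "\<dots> \<longleftrightarrow> nonsingular_on ?A ?G"
      using G assms(1) inj(1) by (intro nonsingular_on_reindex) (auto intro: finite_subset inj_on_subset)
    also have "\<dots> \<longleftrightarrow> free (pattern (1, 0) (0, 1) F)"
      using free_pattern_iff_nonsingular True X0 by simp
    finally show ?thesis using True by simp
  qed (use assms(2) in blast)
  then have "feasible D = feasible (sys (1, 0) (0, 1))"
    by (intro set_eqI) (simp only: feasible_sys)
  then have "D = sys (1, 0) (0, 1)" by (intro set_system.equality) auto
  then show thesis using that lagrangian_axioms by blast
qed

section \<open>The Fano plane of parity functionals\<close>

lemma any_two_imply_third_linear:
  fixes f g h :: "'v \<Rightarrow> bit"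
  assumes "\<And>v. v \<in> L \<Longrightarrow> f v + g v + h v = 0"
  shows "any_two_imply_third (\<forall>v\<in>L. f v = 0) (\<forall>v\<in>L. g v = 0) (\<forall>v\<in>L. h v = 0)"
proof -
  have "(f v = 0 \<and> g v = 0 \<longrightarrow> h v = 0) \<and> (f v = 0 \<and> h v = 0 \<longrightarrow> g v = 0) \<and>
      (g v = 0 \<and> h v = 0 \<longrightarrow> f v = 0)" if "v \<in> L" for v
    using assms[OF that] by auto
  then show ?thesis unfolding any_two_imply_third_def by blast
qed

theorem corollary4p3:
  fixes D :: "'a set_system" and \<tau> :: "nat \<Rightarrow> 'a \<Rightarrow> 'b"
  assumes "delta_matroid D" and "binary D" and "labelling (ground D) \<tau>"
  shows
    "any_two_imply_third (even_system D) (even_system (plus_all D)) (bipartite D) \<and>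
     any_two_imply_third (even_system D) (even_system (plus_all (dual D))) (bipartite (dual D)) \<and>
     any_two_imply_third (even_system D) (bipartite (dual (plus_all D))) (Z3_bipartite D \<tau>) \<and>
     any_two_imply_third (even_system (plus_all D)) (even_system (plus_all (dual D)))
       (bipartite (dual (plus_all D))) \<and>
     any_two_imply_third (even_system (plus_all D)) (bipartite (dual D)) (Z3_bipartite D \<tau>) \<and>
     any_two_imply_third (bipartite D) (even_system (plus_all (dual D))) (Z3_bipartite D \<tau>) \<and>
     any_two_imply_third (bipartite D) (bipartite (dual D)) (bipartite (dual (plus_all D)))"
proof -
  have D: "finite (ground D)" "feasible D \<subseteq> Pow (ground D)"
    using assms(1) by (auto simp: delta_matroid_def)
  obtain L where L: "lagrangian (ground D) L" "D = lagrangian.sys (ground D) L (1, 0) (0, 1)"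
    using binary_imp_lagrangian[OF D assms(2)] .
  interpret lagrangian "ground D" L by (rule L(1))
  interpret labelled_lagrangian "ground D" L \<tau>
    using assms(3) D(1) by unfold_locales
  have ne: "(1, 0) \<noteq> (0 :: klein)" "(0, 1) \<noteq> (0 :: klein)" "(1, 1) \<noteq> (0 :: klein)"
    by (auto simp: zero_prod_def)
  have plus: "plus_all D = sys (1, 0) (1, 1)"
    and dual: "dual D = sys (0, 1) (1, 0)"
    and plus_dual: "plus_all (dual D) = sys (0, 1) (1, 1)"
    and dual_plus: "dual (plus_all D) = sys (1, 1) (1, 0)"
  proof -
    show plus: "plus_all D = sys (1, 0) (1, 1)"
      using plus_all_sys[OF ne(1,2)] L(2)[symmetric] by simp
    show dual: "dual D = sys (0, 1) (1, 0)"
      using dual_sys[of "(1, 0)" "(0, 1)"] L(2)[symmetric] by simp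
    show "plus_all (dual D) = sys (0, 1) (1, 1)"
      unfolding dual using plus_all_sys[OF ne(2,1)] by simp
    show "dual (plus_all D) = sys (1, 1) (1, 0)"
      unfolding plus by (rule dual_sys)
  qed
  let ?n1 = "parity (1, 0)" and ?n2 = "parity (0, 1)" and ?n3 = "parity (1, 1)"
  have "even_system D \<longleftrightarrow> (\<forall>v\<in>L. ?n3 v = 0)"
    using even_sys_iff[OF ne(1,2)] L(2) by simp
  moreover have "even_system (plus_all D) \<longleftrightarrow> (\<forall>v\<in>L. ?n2 v = 0)"
    using even_sys_iff[OF ne(1,3)] unfolding plus by simp
  moreover have "even_system (plus_all (dual D)) \<longleftrightarrow> (\<forall>v\<in>L. ?n1 v = 0)"
    using even_sys_iff[OF ne(2,3)] unfolding plus_dual by simp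
  moreover have "bipartite D \<longleftrightarrow> (\<forall>v\<in>L. ?n2 v + ?n3 v = 0)"
    using bipartite_sys_iff[OF ne(1,2)] L(2) by simp
  moreover have "bipartite (dual D) \<longleftrightarrow> (\<forall>v\<in>L. ?n1 v + ?n3 v = 0)"
    using bipartite_sys_iff[OF ne(2,1)] unfolding dual by simp
  moreover have "bipartite (dual (plus_all D)) \<longleftrightarrow> (\<forall>v\<in>L. ?n1 v + ?n2 v = 0)"
    using bipartite_sys_iff[OF ne(3,1)] unfolding dual_plus by simp
  moreover have "Z3_bipartite D \<tau> \<longleftrightarrow> (\<forall>v\<in>L. ?n1 v + ?n2 v + ?n3 v = 0)"
    using Z3_bipartite_sys_iff L(2) by simp
  moreover have two: "x + x = 0" "x + (y + (x + y)) = 0" for x y :: bit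
    by (cases x; cases y; simp)+
  ultimately show ?thesis
    by (simp only:) (intro conjI any_two_imply_third_linear, simp_all add: two ac_simps)
qed

end
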